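(* Let $\mathcal{G}$ be a transitive topological groupoid with proper target map such that $\mathcal{G}^0$ is a path-connected finite CW-complex; fix $b\in\mathcal{G}^0$. Assume that $\mathcal{G}_b^b$ is a finite $p$-group for some prime number $p$. Let $X$ be a finite $\mathcal{G}$-CW-complex with anchor map $a_X\colon X\to\mathcal{G}^0$. Suppose that $a_X$ and $a_{\mathcal{G}}:=a_X|_{X^{\mathcal{G}}}\colon X^{\mathcal{G}}\to\mathcal{G}^0$ are fibrations with multiplicative $\chi_p$-Euler characteristics. If a fiber of $a_X$ is mod-$p$ acyclic, then $a_X$ admits a $\mathcal{G}$-equivariant section, i.e. a $\mathcal{G}$-map $\sigma\colon\mathcal{G}^0\to X$ with $a_X\circ\sigma=\mathrm{id}_{\mathcal{G}^0}$.
   Context: All spaces are Hausdorff and compactly generated, and maps are continuous. A topological groupoid $\mathcal{G}$ has an object space $\mathcal{G}^0$ and an arrow space $\mathcal{G}^1$, both Hausdorff, with continuous structure maps (identity $i\colon\mathcal{G}^0\to\mathcal{G}^1$, source $s$, target $t$, inverse, and composition $gh:=g\circ h$, defined when $s(g)=t(h)$), and $s$ (hence $t$) is open. It is transitive if its orbit space $\mathcal{G}^0/\mathcal{G}^1$ is a single point. Proper maps are those for which preimages of compact sets are compact. For $b\in\mathcal{G}^0$: $\mathcal{G}_b^b=\{g\mid s(g)=t(g)=b\}$ (a group) and $\mathcal{G}^b=t^{-1}(b)$. A right $\mathcal{G}$-space is a space $X$ with an anchor map $a_X\colon X\to\mathcal{G}^0$ and a continuous action $(x,g)\mapsto xg$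 defined when $a_X(x)=t(g)$, such that $a_X(xg)=s(g)$, $x\,i(a_X(x))=x$, and $(xg)g'=x(gg')$ whenever defined. A $\mathcal{G}$-map commutes with anchor maps and actions. $\mathcal{G}^0$ is a right $\mathcal{G}$-space with anchor the identity and action $yg=x$ for $g\colon x\to y$. The fixed set is $X^{\mathcal{G}}:=\{x\in X\mid xg=x\ \text{for all } g\in\mathcal{G}_{a_X(x)}^{a_X(x)}\}$. For a subgroup $H\le\mathcal{G}_b^b$, $\mathcal{G}^b/H$ is the quotient of $\mathcal{G}^b$ by the left action of $H$ by composition; it is a right $\mathcal{G}$-space with anchor $[f]\mapsto s(f)$ and action $[f]g=[fg]$. A $\mathcal{G}$-CW-complex is a right $\mathcal{G}$-space $X=\bigcup_n X^n$ (colimit topology), where $X^0$ is a finite disjoint union of $\mathcal{G}$-spaces $\mathcal{G}^b/H_i$ with $H_i\le\mathcal{G}_b^b$ closed, and $X^{n+1}$ is obtained from $X^n$ as the pushout of right $\mathcal{G}$-spaces along finitely many $\mathcal{G}$-equivariant attaching maps $\mathcal{G}^b/H_i\times S^n\to X^n$ and the inclusions $\mathcal{G}^b/H_i\times S^n\hookrightarrow\mathcal{G}^b/H_i\times D^{n+1}$ ($H_i\le\mathcal{G}_b^b$ closed, $\mathcal{G}$ acting on the first factor, anchor map factoring through the first projection). It is finite if it has finitely many cells in total. $\chi_p$ denotes the Euler characteristic with respect to homology with coefficients in $\mathbb{Z}/p\mathbb{Z}$. A fibration $\pi\colon E\to B$ with generic fiber $F$ has multiplicative $\chi_p$-Euler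 characteristic if $\chi_p(E)=\chi_p(F)\chi_p(B)$. A space is mod-$p$ acyclic if it has the mod-$p$ homology of a point. *)

theory Defs
  imports "HOL-Analysis.Analysis" "HOL-Homology.Homology" "HOL-Computational_Algebra.Primes"
begin

section \<open>Topological groupoids\<close>

record ('o, 'a) groupoid =
  Ob :: "'o topology"
  Ar :: "'a topology"
  src :: "'a \<Rightarrow> 'o"
  tgt :: "'a \<Rightarrow> 'o"
  ident :: "'o \<Rightarrow> 'a"
  ginv :: "'a \<Rightarrow> 'a"
  gcomp :: "'a \<Rightarrow> 'a \<Rightarrow> 'a"

text \<open>Products and fibre products of spaces are formed in compactly generated spaces, that is,
  they carry the k-ification of the usual topology. The arrow \<open>gcomp G g h\<close> is \<open>g\<close> after \<open>h\<close>.\<close>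

locale topological_groupoid =
  fixes G :: "('o, 'a) groupoid"
  assumes Ob_space: "Hausdorff_space (Ob G)" "k_space (Ob G)"
    and Ar_space: "Hausdorff_space (Ar G)" "k_space (Ar G)"
    and continuous_src: "continuous_map (Ar G) (Ob G) (src G)"
    and continuous_tgt: "continuous_map (Ar G) (Ob G) (tgt G)"
    and continuous_ident: "continuous_map (Ob G) (Ar G) (ident G)"
    and continuous_ginv: "continuous_map (Ar G) (Ar G) (ginv G)"
    and continuous_gcomp:
      "continuous_map
         (kification (subtopology (prod_topology (Ar G) (Ar G)) {(g, h). src G g = tgt G h}))
         (Ar G) (\<lambda>(g, h). gcomp G g h)"
    and src_ident: "\<And>x. x \<in> topspace (Ob G) \<Longrightarrow> src G (ident G x) = x"
    and tgt_ident: "\<And>x. x \<in> topspace (Ob G) \<Longrightarrow> tgt G (ident G x) = x"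
    and src_ginv: "\<And>g. g \<in> topspace (Ar G) \<Longrightarrow> src G (ginv G g) = tgt G g"
    and tgt_ginv: "\<And>g. g \<in> topspace (Ar G) \<Longrightarrow> tgt G (ginv G g) = src G g"
    and src_gcomp: "\<And>g h. \<lbrakk>g \<in> topspace (Ar G); h \<in> topspace (Ar G); src G g = tgt G h\<rbrakk>
      \<Longrightarrow> src G (gcomp G g h) = src G h"
    and tgt_gcomp: "\<And>g h. \<lbrakk>g \<in> topspace (Ar G); h \<in> topspace (Ar G); src G g = tgt G h\<rbrakk>
      \<Longrightarrow> tgt G (gcomp G g h) = tgt G g"
    and gcomp_assoc: "\<And>g h k. \<lbrakk>g \<in> topspace (Ar G); h \<in> topspace (Ar G); k \<in> topspace (Ar G);
        src G g = tgt G h; src G h = tgt G k\<rbrakk>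
      \<Longrightarrow> gcomp G (gcomp G g h) k = gcomp G g (gcomp G h k)"
    and ident_gcomp: "\<And>g. g \<in> topspace (Ar G) \<Longrightarrow> gcomp G (ident G (tgt G g)) g = g"
    and gcomp_ident: "\<And>g. g \<in> topspace (Ar G) \<Longrightarrow> gcomp G g (ident G (src G g)) = g"
    and ginv_gcomp: "\<And>g. g \<in> topspace (Ar G) \<Longrightarrow> gcomp G (ginv G g) g = ident G (src G g)"
    and gcomp_ginv: "\<And>g. g \<in> topspace (Ar G) \<Longrightarrow> gcomp G g (ginv G g) = ident G (tgt G g)"
    and open_src: "open_map (Ar G) (Ob G) (src G)"

definition orbit_of :: "('o, 'a) groupoid \<Rightarrow> 'o \<Rightarrow> 'o set" where
  "orbit_of G y = {src G g | g. g \<in> topspace (Ar G) \<and> tgt G g = y}"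

definition transitive_groupoid :: "('o, 'a) groupoid \<Rightarrow> bool" where
  "transitive_groupoid G \<longleftrightarrow> is_singleton (orbit_of G ` topspace (Ob G))"

text \<open>The library's \<^const>\<open>proper_map\<close> asks for closed maps with compact fibres instead.\<close>

definition compact_preimages :: "'a topology \<Rightarrow> 'b topology \<Rightarrow> ('a \<Rightarrow> 'b) \<Rightarrow> bool" where
  "compact_preimages X Y f \<longleftrightarrow> continuous_map X Y f \<and>
     (\<forall>K. compactin Y K \<longrightarrow> compactin X {x \<in> topspace X. f x \<in> K})"

definition isotropy_group :: "('o, 'a) groupoid \<Rightarrow> 'o \<Rightarrow> 'a monoid" where
  "isotropy_group G b =
     \<lparr>carrier = {g \<in> topspace (Ar G). src G g = b \<and> tgt G g = b},
      monoid.mult = gcomp G, one = ident G b\<rparr>"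

definition finite_p_group :: "nat \<Rightarrow> 'a monoid \<Rightarrow> bool" where
  "finite_p_group p K \<longleftrightarrow> group K \<and> finite (carrier K) \<and> (\<exists>k. order K = p ^ k)"


section \<open>Right \<open>G\<close>-spaces\<close>

record ('x, 'o, 'a) gspace =
  Space :: "'x topology"
  anchor :: "'x \<Rightarrow> 'o"
  act :: "'x \<Rightarrow> 'a \<Rightarrow> 'x"

definition right_G_space :: "('o, 'a) groupoid \<Rightarrow> ('x, 'o, 'a) gspace \<Rightarrow> bool" where
  "right_G_space G X \<longleftrightarrow>
     Hausdorff_space (Space X) \<and> k_space (Space X) \<and>
     continuous_map (Space X) (Ob G) (anchor X) \<and>
     continuous_map
       (kification (subtopology (prod_topology (Space X) (Ar G)) {(x, g). anchor X x = tgt G g}))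
       (Space X) (\<lambda>(x, g). act X x g) \<and>
     (\<forall>x \<in> topspace (Space X). \<forall>g \<in> topspace (Ar G).
        anchor X x = tgt G g \<longrightarrow> anchor X (act X x g) = src G g) \<and>
     (\<forall>x \<in> topspace (Space X). act X x (ident G (anchor X x)) = x) \<and>
     (\<forall>x \<in> topspace (Space X). \<forall>g \<in> topspace (Ar G). \<forall>h \<in> topspace (Ar G).
        anchor X x = tgt G g \<and> src G g = tgt G h \<longrightarrow>
        act X (act X x g) h = act X x (gcomp G g h))"

definition G_map :: "('o, 'a) groupoid \<Rightarrow> ('x, 'o, 'a) gspace \<Rightarrow> ('y, 'o, 'a) gspace
    \<Rightarrow> ('x \<Rightarrow> 'y) \<Rightarrow> bool" where
  "G_map G X Y f \<longleftrightarrow>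
     continuous_map (Space X) (Space Y) f \<and>
     (\<forall>x \<in> topspace (Space X). anchor Y (f x) = anchor X x) \<and>
     (\<forall>x \<in> topspace (Space X). \<forall>g \<in> topspace (Ar G).
        anchor X x = tgt G g \<longrightarrow> f (act X x g) = act Y (f x) g)"

definition object_gspace :: "('o, 'a) groupoid \<Rightarrow> ('o, 'o, 'a) gspace" where
  "object_gspace G = \<lparr>Space = Ob G, anchor = (\<lambda>y. y), act = (\<lambda>y g. src G g)\<rparr>"

definition fixed_set :: "('o, 'a) groupoid \<Rightarrow> ('x, 'o, 'a) gspace \<Rightarrow> 'x set" where
  "fixed_set G X = {x \<in> topspace (Space X).
     \<forall>g \<in> carrier (isotropy_group G (anchor X x)). act X x g = x}"

definition sub_gspace :: "('x, 'o, 'a) gspace \<Rightarrow> 'x set \<Rightarrow> ('x, 'o, 'a) gspace" where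
  "sub_gspace X S = X\<lparr>Space := subtopology (Space X) S\<rparr>"

definition quotient_topology :: "'a topology \<Rightarrow> ('a \<Rightarrow> 'b) \<Rightarrow> 'b topology" where
  "quotient_topology X q =
     topology (\<lambda>U. U \<subseteq> q ` topspace X \<and> openin X {x \<in> topspace X. q x \<in> U})"

lemma openin_quotient_topology:
  "openin (quotient_topology X q) U \<longleftrightarrow>
     U \<subseteq> q ` topspace X \<and> openin X {x \<in> topspace X. q x \<in> U}"
proof -
  have "istopology (\<lambda>U. U \<subseteq> q ` topspace X \<and> openin X {x \<in> topspace X. q x \<in> U})"
    unfolding istopology_def
  proof (intro conjI allI impI)
    fix S T
    assume S: "S \<subseteq> q ` topspace X \<and> openin X {x \<in> topspace X. q x \<in> S}"
      and T: "T \<subseteq> q ` topspace X \<and> openin X {x \<in> topspace X. q x \<in> T}"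
    then show "S \<inter> T \<subseteq> q ` topspace X" by blast
    have "{x \<in> topspace X. q x \<in> S \<inter> T} =
        {x \<in> topspace X. q x \<in> S} \<inter> {x \<in> topspace X. q x \<in> T}" by blast
    with S T show "openin X {x \<in> topspace X. q x \<in> S \<inter> T}" by (simp add: openin_Int)
  next
    fix \<K>
    assume K: "\<forall>K\<in>\<K>. K \<subseteq> q ` topspace X \<and> openin X {x \<in> topspace X. q x \<in> K}"
    then show "\<Union>\<K> \<subseteq> q ` topspace X" by blast
    have eq: "{x \<in> topspace X. q x \<in> \<Union>\<K>} = (\<Union>K\<in>\<K>. {x \<in> topspace X. q x \<in> K})"
      by blast
    show "openin X {x \<in> topspace X. q x \<in> \<Union>\<K>}"
      unfolding eq by (rule openin_Union) (use K in blast)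
  qed
  then show ?thesis by (simp add: quotient_topology_def)
qed

lemma topspace_quotient_topology [simp]: "topspace (quotient_topology X q) = q ` topspace X"
proof (rule antisym)
  have "openin (quotient_topology X q) (topspace (quotient_topology X q))" by (rule openin_topspace)
  then show "topspace (quotient_topology X q) \<subseteq> q ` topspace X"
    unfolding openin_quotient_topology by (rule conjunct1)
  have "{x \<in> topspace X. q x \<in> q ` topspace X} = topspace X" by blast
  then have "openin (quotient_topology X q) (q ` topspace X)"
    unfolding openin_quotient_topology by simp
  then show "q ` topspace X \<subseteq> topspace (quotient_topology X q)" by (rule openin_subset)
qed

text \<open>The points of \<open>\<G>\<^sup>b/H\<close> are the orbits \<open>{h \<circ> f | h \<in> H}\<close> of arrows \<open>f\<close> with target \<open>b\<close>.
  The source is constant on such an orbit, and \<open>(H f) g\<close> is the orbit of \<open>f g\<close>.\<close>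

definition coset_gspace :: "('o, 'a) groupoid \<Rightarrow> 'o \<Rightarrow> 'a set \<Rightarrow> ('a set, 'o, 'a) gspace" where
  "coset_gspace G b H =
     \<lparr>Space = quotient_topology (subtopology (Ar G) {f. tgt G f = b}) (\<lambda>f. (\<lambda>h. gcomp G h f) ` H),
      anchor = (\<lambda>c. the_elem (src G ` c)),
      act = (\<lambda>c g. (\<lambda>f. gcomp G f g) ` c)\<rparr>"

definition prod_gspace :: "('x, 'o, 'a) gspace \<Rightarrow> 'k topology \<Rightarrow> ('x \<times> 'k, 'o, 'a) gspace" where
  "prod_gspace X K =
     \<lparr>Space = kification (prod_topology (Space X) K),
      anchor = (\<lambda>(x, z). anchor X x),
      act = (\<lambda>(x, z) g. (act X x g, z))\<rparr>"

definition sum_gspace :: "'i set \<Rightarrow> ('i \<Rightarrow> ('x, 'o, 'a) gspace) \<Rightarrow> ('i \<times> 'x, 'o, 'a) gspace" where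
  "sum_gspace I X =
     \<lparr>Space = sum_topology (\<lambda>i. Space (X i)) I,
      anchor = (\<lambda>(i, x). anchor (X i) x),
      act = (\<lambda>(i, x) g. (i, act (X i) x g))\<rparr>"


section \<open>Cell complexes\<close>

definition disk :: "nat \<Rightarrow> (nat \<Rightarrow> real) topology" where
  "disk n = subtopology (Euclidean_space n) {x. (\<Sum>i<n. x i ^ 2) \<le> 1}"

text \<open>The square formed by \<open>f : A \<rightarrow> B\<close>, \<open>i : A \<rightarrow> C\<close>, \<open>h : B \<rightarrow> D\<close> and \<open>k : C \<rightarrow> D\<close> is a pushout:
  \<open>D\<close> is the quotient of the disjoint union of \<open>B\<close> and \<open>C\<close> by the equivalence relation generated
  by \<open>f a \<sim> i a\<close>.\<close>

definition pushout_square :: "'a topology \<Rightarrow> 'b topology \<Rightarrow> 'c topology \<Rightarrow> 'd topology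
    \<Rightarrow> ('a \<Rightarrow> 'b) \<Rightarrow> ('a \<Rightarrow> 'c) \<Rightarrow> ('b \<Rightarrow> 'd) \<Rightarrow> ('c \<Rightarrow> 'd) \<Rightarrow> bool" where
  "pushout_square A B C D f i h k \<longleftrightarrow>
     continuous_map A B f \<and> continuous_map A C i \<and>
     topspace D = h ` topspace B \<union> k ` topspace C \<and>
     (\<forall>U \<subseteq> topspace D. openin D U \<longleftrightarrow>
        openin B {x \<in> topspace B. h x \<in> U} \<and> openin C {x \<in> topspace C. k x \<in> U}) \<and>
     (\<forall>u \<in> Inl ` topspace B \<union> Inr ` topspace C. \<forall>v \<in> Inl ` topspace B \<union> Inr ` topspace C.
        case_sum h k u = case_sum h k v \<longleftrightarrow>
        equivclp (\<lambda>u v. \<exists>a \<in> topspace A. u = Inl (f a) \<and> v = Inr (i a)) u v)"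

text \<open>The topology on \<open>X\<close> is that of the colimit of the subspaces \<open>sk n\<close>.\<close>

definition colimit_of :: "'x topology \<Rightarrow> (nat \<Rightarrow> 'x set) \<Rightarrow> bool" where
  "colimit_of X sk \<longleftrightarrow> topspace X = (\<Union>n. sk n) \<and>
     (\<forall>U \<subseteq> topspace X. openin X U \<longleftrightarrow> (\<forall>n. openin (subtopology X (sk n)) (U \<inter> sk n)))"

text \<open>In a structure with finitely many cells in each dimension, \<open>N n\<close> is the number of \<open>n\<close>-cells.
  Note that \<^term>\<open>nsphere n\<close> is the boundary sphere of \<^term>\<open>disk (Suc n)\<close>.\<close>

definition finite_CW_complex :: "'x topology \<Rightarrow> bool" where
  "finite_CW_complex X \<longleftrightarrow> Hausdorff_space X \<and>
     (\<exists>(sk :: nat \<Rightarrow> 'x set) (N :: nat \<Rightarrow> nat).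
        colimit_of X sk \<and>
        finite {n. N n \<noteq> 0} \<and>
        finite (sk 0) \<and> card (sk 0) = N 0 \<and>
        subtopology X (sk 0) = discrete_topology (sk 0) \<and>
        (\<forall>n. \<exists>\<phi> \<Phi>.
           pushout_square
             (sum_topology (\<lambda>_. nsphere n) {..<N (Suc n)}) (subtopology X (sk n))
             (sum_topology (\<lambda>_. disk (Suc n)) {..<N (Suc n)}) (subtopology X (sk (Suc n)))
             \<phi> id id \<Phi>))"

text \<open>\<open>H n i\<close> is the subgroup belonging to the \<open>i\<close>-th \<open>n\<close>-cell.\<close>

definition G_CW_structure :: "('o, 'a) groupoid \<Rightarrow> 'o \<Rightarrow> ('x, 'o, 'a) gspace
    \<Rightarrow> (nat \<Rightarrow> 'x set) \<Rightarrow> (nat \<Rightarrow> nat) \<Rightarrow> (nat \<Rightarrow> nat \<Rightarrow> 'a set) \<Rightarrow> bool" where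
  "G_CW_structure G b X sk N H \<longleftrightarrow>
     right_G_space G X \<and>
     colimit_of (Space X) sk \<and>
     (\<forall>n. \<forall>i<N n. subgroup (H n i) (isotropy_group G b) \<and>
        closedin (subtopology (Ar G) (carrier (isotropy_group G b))) (H n i)) \<and>
     (\<exists>\<theta>. G_map G (sum_gspace {..<N 0} (\<lambda>i. coset_gspace G b (H 0 i))) (sub_gspace X (sk 0)) \<theta> \<and>
        homeomorphic_map (Space (sum_gspace {..<N 0} (\<lambda>i. coset_gspace G b (H 0 i))))
          (subtopology (Space X) (sk 0)) \<theta>) \<and>
     (\<forall>n. \<exists>\<phi> \<Phi>.
        let spheres = sum_gspace {..<N (Suc n)}
              (\<lambda>i. prod_gspace (coset_gspace G b (H (Suc n) i)) (nsphere n));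
            disks = sum_gspace {..<N (Suc n)}
              (\<lambda>i. prod_gspace (coset_gspace G b (H (Suc n) i)) (disk (Suc n)))
        in G_map G spheres (sub_gspace X (sk n)) \<phi> \<and>
           G_map G disks (sub_gspace X (sk (Suc n))) \<Phi> \<and>
           pushout_square (Space spheres) (subtopology (Space X) (sk n))
             (Space disks) (subtopology (Space X) (sk (Suc n))) \<phi> id id \<Phi>)"

definition finite_G_CW_complex :: "('o, 'a) groupoid \<Rightarrow> 'o \<Rightarrow> ('x, 'o, 'a) gspace \<Rightarrow> bool" where
  "finite_G_CW_complex G b X \<longleftrightarrow>
     (\<exists>sk N H. G_CW_structure G b X sk N H \<and> finite {n. N n \<noteq> 0})"


section \<open>Fibrations\<close>

text \<open>Serre fibrations: the homotopy lifting property is required for all disks. Surjectivity is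
  not required.\<close>

definition fibration :: "'e topology \<Rightarrow> 'b topology \<Rightarrow> ('e \<Rightarrow> 'b) \<Rightarrow> bool" where
  "fibration E B \<pi> \<longleftrightarrow> continuous_map E B \<pi> \<and>
     (\<forall>n f h.
        continuous_map (disk n) E f \<and>
        continuous_map (prod_topology (disk n) (top_of_set {0..1::real})) B h \<and>
        (\<forall>z \<in> topspace (disk n). h (z, 0) = \<pi> (f z)) \<longrightarrow>
        (\<exists>k. continuous_map (prod_topology (disk n) (top_of_set {0..1::real})) E k \<and>
           (\<forall>z \<in> topspace (disk n). k (z, 0) = f z) \<and>
           (\<forall>z \<in> topspace (disk n). \<forall>t \<in> {0..1}. \<pi> (k (z, t)) = h (z, t))))"

definition fibre :: "'e topology \<Rightarrow> ('e \<Rightarrow> 'b) \<Rightarrow> 'b \<Rightarrow> 'e topology" where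
  "fibre E \<pi> y = subtopology E {x. \<pi> x = y}"


section \<open>Homology with coefficients in \<open>\<int>/p\<int>\<close>\<close>

text \<open>This is the homology of the complex \<open>C \<otimes> \<int>/p\<int> = C/pC\<close>, where \<open>C\<close> is the integral singular
  chain complex. As in the library's relative homology, elements of the quotient complex are
  represented by integral chains: a cycle modulo \<open>p\<close> has its boundary in \<open>pC\<close>, and the boundaries
  modulo \<open>p\<close> form \<open>\<partial>C + pC\<close>.\<close>

definition mod_cycle_set :: "nat \<Rightarrow> nat \<Rightarrow> 'a topology \<Rightarrow> 'a chain set" where
  "mod_cycle_set p n X = {c. singular_chain n X c \<and>
     (\<exists>d. singular_chain (n - 1) X d \<and> chain_boundary n c = frag_cmul (int p) d)}"

definition mod_boundary_set :: "nat \<Rightarrow> nat \<Rightarrow> 'a topology \<Rightarrow> 'a chain set" where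
  "mod_boundary_set p n X = {chain_boundary (Suc n) e + frag_cmul (int p) d | e d.
     singular_chain (Suc n) X e \<and> singular_chain n X d}"

definition mod_homology_group :: "nat \<Rightarrow> nat \<Rightarrow> 'a topology \<Rightarrow> 'a chain set monoid" where
  "mod_homology_group p n X =
     subgroup_generated (chain_group n X) (mod_cycle_set p n X) Mod mod_boundary_set p n X"

text \<open>For prime \<open>p\<close> the group \<open>H\<^sub>n(X; \<int>/p\<int>)\<close> is a vector space over \<open>\<int>/p\<int>\<close>, whose subspaces are its
  subgroups; its dimension is the least cardinality of a spanning set.\<close>

definition mod_betti :: "nat \<Rightarrow> nat \<Rightarrow> 'a topology \<Rightarrow> nat" where
  "mod_betti p n X =
     (LEAST d. \<exists>B \<subseteq> carrier (mod_homology_group p n X). finite B \<and> card B = d \<and>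
        generate (mod_homology_group p n X) B = carrier (mod_homology_group p n X))"

text \<open>Meaningful for spaces whose total homology with coefficients in \<open>\<int>/p\<int>\<close> is
  finite-dimensional.\<close>

definition mod_euler_char :: "nat \<Rightarrow> 'a topology \<Rightarrow> int" where
  "mod_euler_char p X =
     (\<Sum>n | \<not> trivial_group (mod_homology_group p n X). (-1) ^ n * int (mod_betti p n X))"

text \<open>The fibres over a path-connected base are weakly equivalent, so any of them is a generic
  fibre.\<close>

definition multiplicative_euler_char ::
    "nat \<Rightarrow> 'e topology \<Rightarrow> 'b topology \<Rightarrow> ('e \<Rightarrow> 'b) \<Rightarrow> bool" where
  "multiplicative_euler_char p E B \<pi> \<longleftrightarrow>
     (\<forall>y \<in> topspace B.
        mod_euler_char p E = mod_euler_char p (fibre E \<pi> y) * mod_euler_char p B)"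

definition mod_acyclic :: "nat \<Rightarrow> 'a topology \<Rightarrow> bool" where
  "mod_acyclic p X \<longleftrightarrow>
     (\<forall>n. mod_homology_group p n X \<cong> mod_homology_group p n (discrete_topology {()}))"

end

theory Submission
  imports Defs
begin

text \<open>The fibre \<open>F\<close> of \<open>X\<close> over an object \<open>y\<close> is a finite CW complex: a cell \<open>\<G>\<^sup>b/H \<times> D\<^sup>n\<close> of \<open>X\<close>
  contributes one \<open>n\<close>-cell for each coset of \<open>H\<close> in the isotropy group \<open>P\<close> of \<open>b\<close>. If every \<open>H\<close> were a
  proper subgroup of the \<open>p\<close>-group \<open>P\<close>, then the number of cells of \<open>F\<close> in each dimension would be
  divisible by \<open>p\<close>, and so would be the Euler characteristic of \<open>F\<close> with coefficients in \<open>\<int>/p\<int>\<close>.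
  It is 1 for an acyclic \<open>F\<close>, so some \<open>H\<close> equals \<open>P\<close>, and a point \<open>x\<close> of such a cell over \<open>b\<close> is fixed
  by \<open>P\<close>. The section sends \<open>y\<close> to \<open>x g\<close> for any arrow \<open>g\<close> from \<open>y\<close> to \<open>b\<close>.

  Only orders of finite groups are needed for the Euler characteristic: attaching an \<open>n\<close>-cell either
  multiplies the order of the \<open>n\<close>-th homology group by \<open>p\<close> or divides that of the \<open>(n-1)\<close>-st by \<open>p\<close>.\<close>

section \<open>Counting cosets\<close>

text \<open>Excision, homotopy invariance and the homology of spheres enter through integral
  relative homology; the passage to coefficients in Z/p happens once, at chain level. For a single
  cell the integral relative homology is free, so no Tor term arises and the relative homology
  modulo p is Z/p, in degree n only. What remains of the long exact sequence is 0 -> H_n(A) ->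
  H_n(X) -> Z/p -> H_{n-1}(A) -> H_{n-1}(X) -> 0, and it is read off as equations between indices of
  subgroups of chain groups. The image of the generator in H_{n-1}(A) decides which of the two
  orders changes.

  The topological obstacle is that a fibre is a mere subspace of X, not given as a colimit of its
  own cells. But a finite union of images of disks in a Hausdorff space is compact, and a continuous
  map from a disk to a Hausdorff space is closed, so the subspace topology is already the one of a
  cell attachment. This is why compactness is carried through the inductions.\<close>

definition add_subgroup :: "'a::ab_group_add set \<Rightarrow> bool" where
  "add_subgroup S \<longleftrightarrow> 0 \<in> S \<and> (\<forall>x\<in>S. \<forall>y\<in>S. x - y \<in> S)"

lemma add_subgroup_zero: "add_subgroup S \<Longrightarrow> 0 \<in> S"
  and add_subgroup_diff: "add_subgroup S \<Longrightarrow> x \<in> S \<Longrightarrow> y \<in> S \<Longrightarrow> x - y \<in> S"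
  by (auto simp: add_subgroup_def)

lemma add_subgroup_minus: "add_subgroup S \<Longrightarrow> x \<in> S \<Longrightarrow> - x \<in> S"
  using add_subgroup_diff [of S 0 x] by (simp add: add_subgroup_zero)

lemma add_subgroup_add: "add_subgroup S \<Longrightarrow> x \<in> S \<Longrightarrow> y \<in> S \<Longrightarrow> x + y \<in> S"
  using add_subgroup_diff [of S x "- y"] by (simp add: add_subgroup_minus)

lemma add_subgroup_Int: "add_subgroup S \<Longrightarrow> add_subgroup T \<Longrightarrow> add_subgroup (S \<inter> T)"
  by (auto simp: add_subgroup_def)

definition coset :: "'a::ab_group_add set \<Rightarrow> 'a \<Rightarrow> 'a set" where
  "coset B c = {x. x - c \<in> B}"

lemma coset_eq_iff: "add_subgroup B \<Longrightarrow> coset B c = coset B d \<longleftrightarrow> c - d \<in> B"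
proof
  assume B: "add_subgroup B" and "coset B c = coset B d"
  moreover have "c \<in> coset B c" using B by (simp add: coset_def add_subgroup_zero)
  ultimately show "c - d \<in> B" by (simp add: coset_def)
next
  assume B: "add_subgroup B" and cd: "c - d \<in> B"
  have "x - c \<in> B \<longleftrightarrow> x - d \<in> B" for x
    using add_subgroup_add [OF B _ cd, of "x - c"] add_subgroup_diff [OF B _ cd, of "x - d"] by auto
  then show "coset B c = coset B d" by (simp add: coset_def)
qed

text \<open>Sending \<open>f x\<close> to \<open>g x\<close> is a well-defined bijection of the
  images. No finiteness is assumed, so the counting also covers quotients not yet known to be
  finite, whose \<open>card\<close> is 0.\<close>

lemma card_image_same_kernel:
  assumes "\<And>x y. x \<in> S \<Longrightarrow> y \<in> S \<Longrightarrow> f x = f y \<longleftrightarrow> g x = g y"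
  shows "card (f ` S) = card (g ` S)"
proof (rule bij_betw_same_card)
  let ?h = "\<lambda>u. g (inv_into S f u)"
  have h: "?h (f x) = g x" if "x \<in> S" for x
    using assms that by (metis f_inv_into_f imageI inv_into_into)
  show "bij_betw ?h (f ` S) (g ` S)"
    unfolding bij_betw_def inj_on_def using h assms by (auto simp: image_image)
qed

text \<open>Second isomorphism theorem: every coset of \<open>B\<close> in \<open>Z\<close> meets
  \<open>Z'\<close>, and \<open>B\<close> and \<open>B'\<close> identify the same pairs in
  \<open>Z'\<close>. In its uses \<open>Z'\<close> consists of the cycles of a subspace.\<close>

lemma card_coset_second_iso:
  assumes "add_subgroup B" "add_subgroup B'" "Z' \<subseteq> Z" "\<And>x. x \<in> Z \<Longrightarrow> \<exists>y\<in>Z'. x - y \<in> B"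
    and "\<And>x y. x \<in> Z' \<Longrightarrow> y \<in> Z' \<Longrightarrow> x - y \<in> B \<longleftrightarrow> x - y \<in> B'"
  shows "card (coset B ` Z) = card (coset B' ` Z')"
proof -
  have "coset B ` Z = coset B ` Z'"
    using assms(3,4) coset_eq_iff [OF assms(1)] by (fastforce simp: image_iff)
  moreover have "card (coset B ` Z') = card (coset B' ` Z')"
    by (rule card_image_same_kernel) (simp add: coset_eq_iff assms)
  ultimately show ?thesis by simp
qed

lemma card_coset_mult:
  assumes B: "add_subgroup B" and M: "add_subgroup M" and Z: "add_subgroup Z"
    and "B \<subseteq> M" "M \<subseteq> Z"
  shows "card (coset B ` Z) = card (coset M ` Z) * card (coset B ` M)"
proof -
  \<comment> \<open>\<open>r\<close> picks a representative in each coset of \<open>M\<close>; the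
    offset \<open>c - r c\<close> lies in \<open>M\<close> and gives the second coordinate of
    \<open>?g\<close>.\<close>
  define r where "r c = inv_into Z (coset M) (coset M c)" for c
  have r: "r c \<in> Z" "c - r c \<in> M" if "c \<in> Z" for c
  proof -
    show "r c \<in> Z" unfolding r_def using that by (simp add: inv_into_into)
    have "coset M (r c) = coset M c" unfolding r_def using that by (simp add: f_inv_into_f)
    then show "c - r c \<in> M" by (metis coset_eq_iff M)
  qed
  have req: "coset M c = coset M d \<Longrightarrow> r c = r d" for c d by (simp add: r_def)
  let ?g = "\<lambda>c. (coset M c, coset B (c - r c))"
  have "card (coset B ` Z) = card (?g ` Z)"
  proof (rule card_image_same_kernel)
    fix x y assume "x \<in> Z" "y \<in> Z"
    show "coset B x = coset B y \<longleftrightarrow> ?g x = ?g y"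
    proof
      assume "coset B x = coset B y"
      then have xy: "x - y \<in> B" by (simp add: coset_eq_iff B)
      then have "coset M x = coset M y" using assms by (auto simp: coset_eq_iff)
      with xy show "?g x = ?g y" using req [of x y] by (simp add: coset_eq_iff B)
    next
      assume "?g x = ?g y"
      then show "coset B x = coset B y" using req [of x y] by (simp add: coset_eq_iff B)
    qed
  qed
  also have "?g ` Z = (coset M ` Z) \<times> (coset B ` M)"
  proof
    show "?g ` Z \<subseteq> (coset M ` Z) \<times> (coset B ` M)" using r by auto
    show "(coset M ` Z) \<times> (coset B ` M) \<subseteq> ?g ` Z"
    proof clarify
      fix c m assume c: "c \<in> Z" and m: "m \<in> M"
      \<comment> \<open>Adding \<open>m\<close> does not leave the coset of \<open>M\<close>, so
        \<open>?d\<close> has the same representative as \<open>c\<close>, and its offset is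
        \<open>m\<close>.\<close>
      let ?d = "r c + m"
      have d: "?d \<in> Z" using add_subgroup_add [OF Z r(1) [OF c]] m assms(5) by blast
      have "c - ?d \<in> M" using add_subgroup_diff [OF M r(2) [OF c] m] by (simp only: diff_diff_eq)
      then have eq: "coset M c = coset M ?d" by (simp only: coset_eq_iff [OF M])
      have dm: "?d - r ?d = m" by (simp only: req [OF eq, symmetric] add_diff_cancel_left')
      have "?g ?d = (coset M c, coset B m)" by (simp only: dm eq [symmetric])
      then show "(coset M c, coset B m) \<in> ?g ` Z" by (rule image_eqI [OF sym d])
    qed
  qed
  finally show ?thesis by (simp add: card_cartesian_product)
qed

lemma frag_cmul_in_subgroup:
  fixes M :: "('a \<Rightarrow>\<^sub>0 int) set"
  assumes "add_subgroup M" "z \<in> M"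
  shows "frag_cmul m z \<in> M"
proof -
  have nat: "frag_cmul (int n) z \<in> M" for n
    by (induction n)
      (auto simp: add_subgroup_zero frag_cmul_distrib add_subgroup_add assms)
  show ?thesis
  proof (cases "m \<ge> 0")
    case True
    then show ?thesis using nat [of "nat m"] by simp
  next
    case False
    then have "frag_cmul m z = - frag_cmul (int (nat (- m))) z" by simp
    then show ?thesis using nat add_subgroup_minus [OF assms(1)] by presburger
  qed
qed

text \<open>Bezout: \<open>1 = u p + v m\<close>. Boundaries modulo p contain all p-fold chains, so
  for them a multiple prime to p detects whether \<open>w\<close> bounds.\<close>

lemma cmul_coprime_in_subgroup:
  fixes B :: "('a \<Rightarrow>\<^sub>0 int) set"
  assumes B: "add_subgroup B" and p: "prime p"
    and "frag_cmul (int p) w \<in> B" "frag_cmul m w \<in> B" "\<not> int p dvd m"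
  shows "w \<in> B"
proof -
  have "coprime (int p) m"
    using assms by (intro prime_imp_coprime) auto
  then obtain u v where uv: "u * int p + v * m = 1"
    using bezout_int [of "int p" m] by (auto simp: coprime_iff_gcd_eq_1)
  have "frag_cmul u (frag_cmul (int p) w) + frag_cmul v (frag_cmul m w) \<in> B"
    by (intro add_subgroup_add [OF B] frag_cmul_in_subgroup [OF B] assms)
  then have "frag_cmul (u * int p + v * m) w \<in> B"
    by (simp only: frag_cmul_distrib frag_cmul_cmul)
  then show ?thesis using uv by simp
qed

text \<open>\<open>Z / M\<close> is cyclic on the class of \<open>z\<close>, whose annihilator is
  generated by p, so the multiples \<open>i z\<close> with \<open>0 \<le> i < p\<close> represent
  every coset once.\<close>

lemma card_coset_cyclic:
  fixes M Z :: "('a \<Rightarrow>\<^sub>0 int) set"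
  assumes M: "add_subgroup M" and Z: "add_subgroup Z" and z: "z \<in> Z"
    and gen: "\<And>c. c \<in> Z \<Longrightarrow> \<exists>m. c - frag_cmul m z \<in> M"
    and ord: "\<And>m. frag_cmul m z \<in> M \<longleftrightarrow> int p dvd m"
    and p: "p > 0"
  shows "card (coset M ` Z) = p"
proof -
  let ?f = "\<lambda>i::int. coset M (frag_cmul i z)"
  have f_eq: "?f i = ?f j \<longleftrightarrow> int p dvd (i - j)" for i j
    by (simp add: coset_eq_iff M ord flip: frag_cmul_diff_distrib)
  have "coset M ` Z = ?f ` {0..<int p}"
  proof
    show "?f ` {0..<int p} \<subseteq> coset M ` Z" using frag_cmul_in_subgroup [OF Z z] by auto
    show "coset M ` Z \<subseteq> ?f ` {0..<int p}"
    proof clarify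
      fix c assume "c \<in> Z"
      then obtain m where "c - frag_cmul m z \<in> M" using gen by blast
      then have "coset M c = ?f m" by (simp add: coset_eq_iff M)
      also have "\<dots> = ?f (m mod int p)" unfolding f_eq by (simp add: mod_eq_dvd_iff [symmetric])
      finally show "coset M c \<in> ?f ` {0..<int p}" using p by force
    qed
  qed
  moreover have "inj_on ?f {0..<int p}"
  proof (rule inj_onI)
    fix i j assume ij: "i \<in> {0..<int p}" "j \<in> {0..<int p}" "?f i = ?f j"
    then have "i mod int p = j mod int p" unfolding f_eq by (simp only: mod_eq_dvd_iff)
    then show "i = j" using ij(1,2) by simp
  qed
  ultimately show ?thesis by (simp add: card_image)
qed

section \<open>The Euler characteristic modulo \<open>p\<close> under attaching a cell\<close>

definition mod_homology_card :: "nat \<Rightarrow> nat \<Rightarrow> 'a topology \<Rightarrow> nat" where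
  "mod_homology_card p k X = card (coset (mod_boundary_set p k X) ` mod_cycle_set p k X)"

text \<open>The boundaries of the relative complex \<open>C(X) / (C(A) + p C(X))\<close>, again
  represented by integral chains of \<open>X\<close>.\<close>

definition mod_relboundary_set :: "nat \<Rightarrow> nat \<Rightarrow> 'a topology \<Rightarrow> 'a set \<Rightarrow> 'a chain set" where
  "mod_relboundary_set p k X A =
     {b + a | b a. b \<in> mod_boundary_set p k X \<and> singular_chain k (subtopology X A) a}"

lemma frag_cmul_diff2: "frag_cmul c (a - b) = frag_cmul c a - frag_cmul c b"
  by (rule poly_mapping_eqI) (simp add: lookup_minus algebra_simps)

lemma add_frag_cmul_uminus: "c + frag_cmul (- m) d = c - frag_cmul m d"
  by (rule poly_mapping_eqI) (simp add: lookup_add lookup_minus)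

text \<open>A nonzero multiple involves the same simplices. Hence \<open>C(X) / C(A)\<close> is
  torsion free, which below allows division by p without leaving \<open>A\<close>.\<close>

lemma singular_chain_cmulD:
  "m \<noteq> 0 \<Longrightarrow> singular_chain k X (frag_cmul m c) \<Longrightarrow> singular_chain k X c"
  by (auto simp: singular_chain_def subset_iff)

lemma singular_chain_subset: "singular_chain k (subtopology X A) c \<Longrightarrow> singular_chain k X c"
  by (simp add: singular_chain_subtopology)

lemma add_subgroup_mod_cycle_set: "add_subgroup (mod_cycle_set p k X)"
  unfolding add_subgroup_def
proof (intro conjI ballI)
  show "0 \<in> mod_cycle_set p k X"
    unfolding mod_cycle_set_def by (auto intro!: exI [of _ 0])
  fix x y assume "x \<in> mod_cycle_set p k X" "y \<in> mod_cycle_set p k X"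
  then obtain d e where "singular_chain k X x" "singular_chain k X y"
    "singular_chain (k - 1) X d" "chain_boundary k x = frag_cmul (int p) d"
    "singular_chain (k - 1) X e" "chain_boundary k y = frag_cmul (int p) e"
    unfolding mod_cycle_set_def by blast
  then show "x - y \<in> mod_cycle_set p k X"
    unfolding mod_cycle_set_def
    by (intro CollectI conjI exI [of _ "d - e"])
      (simp_all add: singular_chain_diff chain_boundary_diff frag_cmul_diff2)
qed

lemma add_subgroup_mod_boundary_set: "add_subgroup (mod_boundary_set p k X)"
  unfolding add_subgroup_def
proof (intro conjI ballI)
  show "0 \<in> mod_boundary_set p k X"
    unfolding mod_boundary_set_def by (auto intro!: exI [of _ 0])
  fix x y assume "x \<in> mod_boundary_set p k X" "y \<in> mod_boundary_set p k X"
  then obtain d e d' e' where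
    "x = chain_boundary (Suc k) e + frag_cmul (int p) d"
    "singular_chain (Suc k) X e" "singular_chain k X d"
    "y = chain_boundary (Suc k) e' + frag_cmul (int p) d'"
    "singular_chain (Suc k) X e'" "singular_chain k X d'"
    unfolding mod_boundary_set_def by blast
  then show "x - y \<in> mod_boundary_set p k X"
    unfolding mod_boundary_set_def
    by (intro CollectI exI [of _ "e - e'"] exI [of _ "d - d'"])
      (simp add: singular_chain_diff chain_boundary_diff frag_cmul_diff2)
qed

lemma mod_boundary_setI:
  "singular_chain (Suc k) X e \<Longrightarrow> singular_chain k X d
    \<Longrightarrow> chain_boundary (Suc k) e + frag_cmul (int p) d \<in> mod_boundary_set p k X"
  unfolding mod_boundary_set_def by blast

lemma chain_boundary_in_mod_boundary_set:
  "singular_chain (Suc k) X e \<Longrightarrow> chain_boundary (Suc k) e \<in> mod_boundary_set p k X"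
  using mod_boundary_setI [of k X e 0 p] by simp

lemma cmul_in_mod_boundary_set:
  assumes "int p dvd m" "singular_chain k X d" shows "frag_cmul m d \<in> mod_boundary_set p k X"
proof -
  obtain i where "m = int p * i" using assms(1) by blast
  then show ?thesis using mod_boundary_setI [of k X 0 "frag_cmul i d" p] assms(2)
    by (simp add: singular_chain_cmul)
qed

lemma mod_boundary_subset_cycle: "mod_boundary_set p k X \<subseteq> mod_cycle_set p k X"
proof
  fix c assume "c \<in> mod_boundary_set p k X"
  then obtain e d where c: "c = chain_boundary (Suc k) e + frag_cmul (int p) d"
    and e: "singular_chain (Suc k) X e" and d: "singular_chain k X d"
    unfolding mod_boundary_set_def by blast
  have "chain_boundary k c = frag_cmul (int p) (chain_boundary k d)"
    by (simp add: c chain_boundary_add chain_boundary_cmul chain_boundary_boundary_alt [OF e])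
  moreover have "singular_chain k X c"
    unfolding c by (intro singular_chain_add singular_chain_boundary_alt e singular_chain_cmul d)
  ultimately show "c \<in> mod_cycle_set p k X"
    using singular_chain_boundary [OF d] by (auto simp: mod_cycle_set_def)
qed

lemma mod_cycle_set_mono: "mod_cycle_set p k (subtopology X A) \<subseteq> mod_cycle_set p k X"
  unfolding mod_cycle_set_def using singular_chain_subset by blast

lemma mod_boundary_set_mono: "mod_boundary_set p k (subtopology X A) \<subseteq> mod_boundary_set p k X"
  unfolding mod_boundary_set_def using singular_chain_subset by blast

lemma add_subgroup_mod_relboundary_set: "add_subgroup (mod_relboundary_set p k X A)"
  unfolding add_subgroup_def
proof (intro conjI ballI)
  show "0 \<in> mod_relboundary_set p k X A"
    unfolding mod_relboundary_set_def
    using add_subgroup_zero [OF add_subgroup_mod_boundary_set] by force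
  fix x y assume "x \<in> mod_relboundary_set p k X A" "y \<in> mod_relboundary_set p k X A"
  then obtain b a b' a' where
    "x = b + a" "b \<in> mod_boundary_set p k X" "singular_chain k (subtopology X A) a"
    "y = b' + a'" "b' \<in> mod_boundary_set p k X" "singular_chain k (subtopology X A) a'"
    unfolding mod_relboundary_set_def by blast
  then show "x - y \<in> mod_relboundary_set p k X A"
    unfolding mod_relboundary_set_def
    by (intro CollectI exI [of _ "b - b'"] exI [of _ "a - a'"])
      (simp add: singular_chain_diff add_subgroup_diff [OF add_subgroup_mod_boundary_set])
qed

lemma mod_boundary_subset_relboundary: "mod_boundary_set p k X \<subseteq> mod_relboundary_set p k X A"
  unfolding mod_relboundary_set_def by force

lemma singular_relboundary_in_mod_relboundary_set:
  assumes "singular_relboundary k X A c" shows "c \<in> mod_relboundary_set p k X A"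
proof -
  obtain d e where "singular_chain (Suc k) X d" "singular_chain k (subtopology X A) e"
    "chain_boundary (Suc k) d + e = c"
    using assms unfolding singular_relboundary by blast
  then show ?thesis
    unfolding mod_relboundary_set_def using chain_boundary_in_mod_boundary_set by blast
qed

text \<open>The boundary is \<open>p d\<close> with \<open>d\<close> a priori in \<open>X\<close>;
  as \<open>p d\<close> lies in \<open>A\<close>, so does \<open>d\<close>.\<close>

lemma mod_cycle_set_subtopology:
  assumes "p > 0" "c \<in> mod_cycle_set p k X" "singular_chain k (subtopology X A) c"
  shows "c \<in> mod_cycle_set p k (subtopology X A)"
proof -
  obtain d where d: "chain_boundary k c = frag_cmul (int p) d"
    using assms by (auto simp: mod_cycle_set_def)
  then have "singular_chain (k - 1) (subtopology X A) d"
    using singular_chain_boundary [OF assms(3)] assms(1)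
    by (metis One_nat_def of_nat_eq_0_iff not_gr_zero singular_chain_cmulD)
  then show ?thesis using assms d by (auto simp: mod_cycle_set_def)
qed

text \<open>Exactness of H_k(A) -> H_k(X) -> H_k(X, A) in the middle, modulo p: the part of
  \<open>c\<close> in \<open>A\<close> differs from \<open>c\<close> by a boundary, so it is itself
  a cycle.\<close>

lemma mod_cycle_relboundary_decompose:
  assumes "p > 0" "c \<in> mod_cycle_set p k X" "c \<in> mod_relboundary_set p k X A"
  shows "\<exists>a \<in> mod_cycle_set p k (subtopology X A). c - a \<in> mod_boundary_set p k X"
proof -
  obtain b a where c: "c = b + a" and b: "b \<in> mod_boundary_set p k X"
    and a: "singular_chain k (subtopology X A) a"
    using assms(3) unfolding mod_relboundary_set_def by blast
  have "a = c - b" using c by simp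
  then have "a \<in> mod_cycle_set p k X"
    using add_subgroup_diff [OF add_subgroup_mod_cycle_set assms(2)] b mod_boundary_subset_cycle
    by blast
  with a assms(1) have "a \<in> mod_cycle_set p k (subtopology X A)"
    by (intro mod_cycle_set_subtopology)
  then show ?thesis using b c by force
qed

text \<open>The relative integral homology of \<open>(X, A)\<close> is infinite cyclic, generated by the class of
  \<open>z\<close>, in degree \<open>n\<close>, and zero in all other degrees.\<close>

definition rel_cell :: "nat \<Rightarrow> 'a topology \<Rightarrow> 'a set \<Rightarrow> 'a chain \<Rightarrow> bool" where
  "rel_cell n X A z \<longleftrightarrow>
     singular_relcycle n X A z \<and>
     (\<forall>c. singular_relcycle n X A c \<longrightarrow> (\<exists>m. singular_relboundary n X A (c - frag_cmul m z))) \<and>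
     (\<forall>m. singular_relboundary n X A (frag_cmul m z) \<longrightarrow> m = 0) \<and>
     (\<forall>k c. k \<noteq> n \<longrightarrow> singular_relcycle k X A c \<longrightarrow> singular_relboundary k X A c)"

section \<open>Homology modulo p of a pair with one free relative class\<close>

context
  fixes n :: nat and X :: "'a topology" and A :: "'a set" and z :: "'a chain" and p :: nat
  assumes rel_cell: "rel_cell n X A z" and p: "prime p"
begin

lemma z_relcycle: "singular_relcycle n X A z"
  and z_generates: "singular_relcycle n X A c \<Longrightarrow> \<exists>m. singular_relboundary n X A (c - frag_cmul m z)"
  and z_free: "singular_relboundary n X A (frag_cmul m z) \<Longrightarrow> m = 0"
  and other_degree: "k \<noteq> n \<Longrightarrow> singular_relcycle k X A c \<Longrightarrow> singular_relboundary k X A c"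
  using rel_cell unfolding rel_cell_def by blast+

lemma p_pos: "p > 0"
  using p by (rule prime_gt_0_nat)

text \<open>The hypotheses make \<open>c\<close> a cycle of \<open>C(X) / (C(A) + p C(X))\<close>.
  As \<open>p d = \<partial>c - a\<close>, the class of \<open>d\<close> is p-torsion in the
  integral relative homology of degree \<open>k - 1\<close>, which is free; so \<open>d\<close>
  bounds relative to \<open>A\<close>, and a chain bounding it corrects \<open>c\<close>. This is
  the vanishing of the Tor term.\<close>

lemma mod_relcycle_lift:
  assumes c: "singular_chain k X c" and d: "singular_chain (k - 1) X d"
    and a: "singular_chain (k - 1) (subtopology X A) a"
    and bd: "chain_boundary k c = frag_cmul (int p) d + a"
  shows "\<exists>e. singular_chain k X e \<and> singular_relcycle k X A (c - frag_cmul (int p) e)"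
proof (cases k)
  case 0
  then have "singular_relcycle k X A c" using c by (simp add: singular_relcycle chain_boundary_def)
  then show ?thesis by (intro exI [of _ 0]) auto
next
  case (Suc j)
  have d': "singular_chain j X d" and a': "singular_chain j (subtopology X A) a"
    using d a Suc by simp_all
  have pd: "frag_cmul (int p) d = chain_boundary (Suc j) c - a"
    using bd Suc by simp
  \<comment> \<open>To see that \<open>d\<close> is a relative cycle: p times its boundary lies in
    \<open>A\<close>, hence so does its boundary.\<close>
  have "frag_cmul (int p) (chain_boundary j d) = - chain_boundary j a"
    using chain_boundary_boundary_alt [of j X c] c Suc
    by (simp add: pd chain_boundary_diff flip: chain_boundary_cmul)
  then have "singular_chain (j - 1) (subtopology X A) (frag_cmul (int p) (chain_boundary j d))"
    using singular_chain_boundary [OF a'] by (simp add: singular_chain_minus)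
  then have "singular_chain (j - 1) (subtopology X A) (chain_boundary j d)"
    using p_pos singular_chain_cmulD [of "int p"] by simp
  with d' have rel: "singular_relcycle j X A d" by (simp add: singular_relcycle)
  have "singular_relboundary j X A d"
  proof (cases "j = n")
    case False
    with rel show ?thesis by (simp add: other_degree)
  next
    \<comment> \<open>In the degree of the generator, \<open>d\<close> is homologous to
      \<open>m z\<close>. Since \<open>p d\<close> bounds relative to \<open>A\<close>, freeness
      gives \<open>p m = 0\<close>.\<close>
    case True
    then obtain m where m: "singular_relboundary n X A (d - frag_cmul m z)"
      using z_generates rel by blast
    have "singular_relboundary n X A (frag_cmul (int p) d)"
      unfolding singular_relboundary pd
      using c a' Suc True singular_chain_minus [of j "subtopology X A" a]
      by (intro exI [of _ c] exI [of _ "- a"]) (simp only: simp_thms add_uminus_conv_diff)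
    from singular_relboundary_diff [OF this singular_relboundary_cmul [OF m, of "int p"]]
    have "singular_relboundary n X A (frag_cmul (int p * m) z)"
      by (simp add: frag_cmul_diff2)
    then have "m = 0" using z_free p_pos by fastforce
    with m True show ?thesis by simp
  qed
  then obtain e a'' where e: "singular_chain (Suc j) X e"
    and a'': "singular_chain j (subtopology X A) a''" and "chain_boundary (Suc j) e + a'' = d"
    unfolding singular_relboundary by blast
  then have "chain_boundary k (c - frag_cmul (int p) e) = a + frag_cmul (int p) a''"
    using bd Suc by (auto simp: chain_boundary_diff chain_boundary_cmul frag_cmul_distrib2)
  then have "singular_relcycle k X A (c - frag_cmul (int p) e)"
    unfolding singular_relcycle
    using c e a' a'' Suc by (simp add: singular_chain_diff singular_chain_cmul singular_chain_add)
  then show ?thesis using e Suc by blast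
qed

lemma mod_relcycle_other_degree:
  assumes "singular_chain k X c" "singular_chain (k - 1) X d"
    "singular_chain (k - 1) (subtopology X A) a"
    "chain_boundary k c = frag_cmul (int p) d + a" and "k \<noteq> n"
  shows "c \<in> mod_relboundary_set p k X A"
proof -
  obtain e where e: "singular_chain k X e" "singular_relcycle k X A (c - frag_cmul (int p) e)"
    using mod_relcycle_lift assms by blast
  have "c - frag_cmul (int p) e \<in> mod_relboundary_set p k X A"
    using e(2) assms(5) by (intro singular_relboundary_in_mod_relboundary_set other_degree)
  moreover have "frag_cmul (int p) e \<in> mod_relboundary_set p k X A"
    using cmul_in_mod_boundary_set [OF dvd_refl e(1)] mod_boundary_subset_relboundary by blast
  ultimately show ?thesis
    using add_subgroup_add [OF add_subgroup_mod_relboundary_set] by (metis diff_add_cancel)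
qed

lemma mod_relcycle_generated:
  assumes "singular_chain n X c" "singular_chain (n - 1) X d"
    "singular_chain (n - 1) (subtopology X A) a"
    "chain_boundary n c = frag_cmul (int p) d + a"
  shows "\<exists>m. c - frag_cmul m z \<in> mod_relboundary_set p n X A"
proof -
  obtain e where e: "singular_chain n X e" "singular_relcycle n X A (c - frag_cmul (int p) e)"
    using mod_relcycle_lift assms by blast
  then obtain m where "singular_relboundary n X A (c - frag_cmul (int p) e - frag_cmul m z)"
    using z_generates by blast
  then have "c - frag_cmul (int p) e - frag_cmul m z \<in> mod_relboundary_set p n X A"
    by (rule singular_relboundary_in_mod_relboundary_set)
  moreover have "frag_cmul (int p) e \<in> mod_relboundary_set p n X A"
    using cmul_in_mod_boundary_set [OF dvd_refl e(1)] mod_boundary_subset_relboundary by blast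
  ultimately have "c - frag_cmul (int p) e - frag_cmul m z + frag_cmul (int p) e
      \<in> mod_relboundary_set p n X A"
    by (rule add_subgroup_add [OF add_subgroup_mod_relboundary_set])
  then show ?thesis by (auto simp: algebra_simps)
qed

text \<open>Integrally, \<open>m z\<close> is homologous to some \<open>p d\<close> relative to
  \<open>A\<close>, and \<open>d\<close> to some \<open>m' z\<close>; freeness then gives
  \<open>m = p m'\<close>. So \<open>z\<close> keeps exact order p after reduction modulo p.\<close>

lemma cmul_z_mod_relboundary:
  assumes "frag_cmul m z \<in> mod_relboundary_set p n X A" shows "int p dvd m"
proof -
  obtain e d a where e: "singular_chain (Suc n) X e" and d: "singular_chain n X d"
    and a: "singular_chain n (subtopology X A) a"
    and eq: "frag_cmul m z = chain_boundary (Suc n) e + frag_cmul (int p) d + a"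
    using assms unfolding mod_relboundary_set_def mod_boundary_set_def by blast
  have rel: "singular_relboundary n X A (frag_cmul m z - frag_cmul (int p) d)"
    unfolding singular_relboundary using e a eq by (intro exI [of _ e] exI [of _ a]) simp
  have "singular_relcycle n X A (frag_cmul (int p) d)"
    using singular_relcycle_diff [OF singular_relcycle_cmul [OF z_relcycle, of m]
        singular_relboundary_imp_relcycle [OF rel]] by simp
  then have "singular_relcycle n X A d"
    using d p_pos singular_chain_cmulD [of "int p"] by (auto simp: singular_relcycle chain_boundary_cmul)
  then obtain m' where "singular_relboundary n X A (d - frag_cmul m' z)"
    using z_generates by blast
  note singular_relboundary_add [OF rel singular_relboundary_cmul [OF this, of "int p"]]
  also have "frag_cmul m z - frag_cmul (int p) d + frag_cmul (int p) (d - frag_cmul m' z)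
      = frag_cmul (m - int p * m') z"
    by (rule poly_mapping_eqI) (simp add: lookup_add lookup_minus algebra_simps)
  finally have "singular_relboundary n X A (frag_cmul (m - int p * m') z)" .
  then have "m - int p * m' = 0" by (rule z_free)
  then show ?thesis by simp
qed

lemma mod_cycle_relcycle:
  assumes "c \<in> mod_cycle_set p k X"
  obtains d where "singular_chain k X c" "singular_chain (k - 1) X d"
    "singular_chain (k - 1) (subtopology X A) 0"
    "chain_boundary k c = frag_cmul (int p) d + 0"
  using assms by (auto simp: mod_cycle_set_def)

lemma mod_cycle_other_degree:
  "c \<in> mod_cycle_set p k X \<Longrightarrow> k \<noteq> n \<Longrightarrow> c \<in> mod_relboundary_set p k X A"
  using mod_relcycle_other_degree by (elim mod_cycle_relcycle)

lemma mod_cycle_generated: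
  "c \<in> mod_cycle_set p n X \<Longrightarrow> \<exists>m. c - frag_cmul m z \<in> mod_relboundary_set p n X A"
  using mod_relcycle_generated by (elim mod_cycle_relcycle)

text \<open>If \<open>a = \<partial>e + p d\<close> is a chain of \<open>A\<close>, then \<open>e\<close> is a relative cycle modulo \<open>p\<close>; subtracting
  from \<open>e\<close> a relative boundary modulo \<open>p\<close> changes \<open>a\<close> by a boundary modulo \<open>p\<close> in \<open>A\<close>.\<close>

lemma mod_boundary_in_subspace:
  assumes a: "singular_chain k (subtopology X A) a" "singular_chain k (subtopology X A) w"
    and d: "singular_chain k X d"
    and eq: "a = chain_boundary (Suc k) e + frag_cmul (int p) d"
    and e: "e - y \<in> mod_relboundary_set p (Suc k) X A" "chain_boundary (Suc k) y = w"
  shows "a - w \<in> mod_boundary_set p k (subtopology X A)"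
proof -
  obtain f g a' where f: "singular_chain (Suc (Suc k)) X f" and g: "singular_chain (Suc k) X g"
    and a': "singular_chain (Suc k) (subtopology X A) a'"
    and e': "e - y = chain_boundary (Suc (Suc k)) f + frag_cmul (int p) g + a'"
    using e(1) unfolding mod_relboundary_set_def mod_boundary_set_def by blast
  let ?h = "d + chain_boundary (Suc k) g"
  have "chain_boundary (Suc k) e - w
      = frag_cmul (int p) (chain_boundary (Suc k) g) + chain_boundary (Suc k) a'"
    using arg_cong [OF e', of "chain_boundary (Suc k)"] e(2) chain_boundary_boundary_alt [OF f]
    by (simp add: chain_boundary_diff chain_boundary_add chain_boundary_cmul)
  then have aw: "a - w = chain_boundary (Suc k) a' + frag_cmul (int p) ?h"
    by (simp add: eq frag_cmul_distrib2 algebra_simps)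
  \<comment> \<open>The right-hand side lies in \<open>A\<close>. Division by p puts the sum
    \<open>?h\<close> in \<open>A\<close>, although its two summands are only known to be chains of
    \<open>X\<close>.\<close>
  then have "frag_cmul (int p) ?h = a - w - chain_boundary (Suc k) a'" by simp
  then have "singular_chain k (subtopology X A) (frag_cmul (int p) ?h)"
    using a singular_chain_boundary_alt [OF a'] by (simp add: singular_chain_diff)
  then have "singular_chain k (subtopology X A) ?h"
    using p_pos singular_chain_cmulD [of "int p"] by simp
  with a' show ?thesis unfolding aw by (rule mod_boundary_setI)
qed

text \<open>From \<open>\<partial>e = a - p d\<close> with \<open>a\<close> in \<open>A\<close>, the
  chain \<open>e\<close> is a cycle modulo p of the pair. So the relative classes control which
  chains of \<open>A\<close> bound in \<open>X\<close>.\<close>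

lemma mod_boundary_relcycle:
  assumes a: "singular_chain k (subtopology X A) a" and "a \<in> mod_boundary_set p k X"
  obtains e d where "singular_chain (Suc k) X e" "singular_chain k X d"
    "a = chain_boundary (Suc k) e + frag_cmul (int p) d"
    "Suc k \<noteq> n \<Longrightarrow> e \<in> mod_relboundary_set p (Suc k) X A"
    "Suc k = n \<Longrightarrow> \<exists>m. e - frag_cmul m z \<in> mod_relboundary_set p (Suc k) X A"
proof -
  obtain e d where e: "singular_chain (Suc k) X e" and d: "singular_chain k X d"
    and eq: "a = chain_boundary (Suc k) e + frag_cmul (int p) d"
    using assms unfolding mod_boundary_set_def by blast
  have bd: "chain_boundary (Suc k) e = frag_cmul (int p) (- d) + a"
    using eq by (auto simp: poly_mapping_eqI lookup_add)
  have d': "singular_chain k X (- d)" using d by (simp add: singular_chain_minus)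
  show thesis
  proof (rule that [OF e d eq])
    show "e \<in> mod_relboundary_set p (Suc k) X A" if "Suc k \<noteq> n"
      using mod_relcycle_other_degree [OF e _ _ bd that] d' a by simp
    show "\<exists>m. e - frag_cmul m z \<in> mod_relboundary_set p (Suc k) X A" if "Suc k = n"
      using mod_relcycle_generated [of e "- d" a] e d' a bd unfolding that [symmetric] by simp
  qed
qed

text \<open>The kernel of H_k(A) -> H_k(X) comes from H_{k+1}(X, A), which is zero modulo p for
  \<open>Suc k \<noteq> n\<close>.\<close>

lemma mod_boundary_set_subtopology:
  assumes a: "singular_chain k (subtopology X A) a" "a \<in> mod_boundary_set p k X" and "Suc k \<noteq> n"
  shows "a \<in> mod_boundary_set p k (subtopology X A)"
proof -
  obtain e d where "singular_chain k X d" "a = chain_boundary (Suc k) e + frag_cmul (int p) d"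
    "e \<in> mod_relboundary_set p (Suc k) X A"
    using mod_boundary_relcycle [OF a] assms(3) by metis
  then show ?thesis using mod_boundary_in_subspace [of k a 0 d e 0] a by simp
qed

section \<open>The exact sequence of the pair as equations between orders\<close>

lemma mod_homology_card_other_degree:
  assumes "k \<noteq> n" "Suc k \<noteq> n"
  shows "mod_homology_card p k X = mod_homology_card p k (subtopology X A)"
  unfolding mod_homology_card_def
proof (rule card_coset_second_iso)
  fix x y assume "x \<in> mod_cycle_set p k (subtopology X A)" "y \<in> mod_cycle_set p k (subtopology X A)"
  then have "singular_chain k (subtopology X A) (x - y)"
    by (auto simp: mod_cycle_set_def intro: singular_chain_diff)
  then show "x - y \<in> mod_boundary_set p k X \<longleftrightarrow> x - y \<in> mod_boundary_set p k (subtopology X A)"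
    using mod_boundary_set_subtopology assms(2) mod_boundary_set_mono by blast
next
  fix x assume "x \<in> mod_cycle_set p k X"
  then show "\<exists>y\<in>mod_cycle_set p k (subtopology X A). x - y \<in> mod_boundary_set p k X"
    by (intro mod_cycle_relboundary_decompose p_pos mod_cycle_other_degree assms)
qed (simp_all add: add_subgroup_mod_boundary_set mod_cycle_set_mono)

lemma z_chain: "singular_chain n X z"
  and boundary_z_chain: "singular_chain (n - 1) (subtopology X A) (chain_boundary n z)"
  using z_relcycle by (simp_all add: singular_relcycle)

lemma boundary_z_cycle: "chain_boundary n z \<in> mod_cycle_set p (n - 1) (subtopology X A)"
proof (cases n)
  case (Suc j)
  then have "chain_boundary (n - 1) (chain_boundary n z) = frag_cmul (int p) 0"
    using chain_boundary_boundary_alt [of j X z] z_chain by simp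
  then show ?thesis using boundary_z_chain unfolding mod_cycle_set_def by blast
qed (auto simp: chain_boundary_def add_subgroup_zero [OF add_subgroup_mod_cycle_set])

text \<open>The connecting homomorphism is the obstruction: if
  \<open>\<partial>z = \<partial>a + p d\<close> with \<open>a\<close> and \<open>d\<close> in
  \<open>A\<close>, then \<open>z - a\<close> is a cycle modulo p with the same relative class. In
  degree 0 the boundary is zero by convention and \<open>z\<close> itself serves.\<close>

lemma lift_z_to_cycle:
  assumes "n = 0 \<or> chain_boundary n z \<in> mod_boundary_set p (n - 1) (subtopology X A)"
  shows "\<exists>z' \<in> mod_cycle_set p n X. \<exists>a. singular_chain n (subtopology X A) a \<and> z' = z - a"
proof (cases n)
  case 0
  then have "z \<in> mod_cycle_set p n X"
    using z_chain by (auto simp: mod_cycle_set_def chain_boundary_def intro!: exI [of _ 0])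
  then show ?thesis by force
next
  case (Suc j)
  then obtain a d where a: "singular_chain n (subtopology X A) a"
    and d: "singular_chain (n - 1) (subtopology X A) d"
    and eq: "chain_boundary n z = chain_boundary n a + frag_cmul (int p) d"
    using assms unfolding mod_boundary_set_def by auto
  have "chain_boundary n (z - a) = frag_cmul (int p) d"
    using eq by (simp add: chain_boundary_diff)
  moreover have "singular_chain n X (z - a)"
    using z_chain singular_chain_subset [OF a] by (rule singular_chain_diff)
  ultimately have "z - a \<in> mod_cycle_set p n X"
    using singular_chain_subset [OF d] by (auto simp: mod_cycle_set_def)
  then show ?thesis using a by blast
qed

text \<open>A cycle modulo \<open>p\<close> with relative class \<open>m z\<close> gives \<open>m \<partial>z = 0\<close> in the homology of \<open>A\<close>
  modulo \<open>p\<close>, and \<open>m\<close> is invertible modulo \<open>p\<close> if the class is nonzero.\<close>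

lemma boundary_z_bounds:
  assumes n: "n > 0" and c: "c \<in> mod_cycle_set p n X" "c \<notin> mod_relboundary_set p n X A"
  shows "chain_boundary n z \<in> mod_boundary_set p (n - 1) (subtopology X A)"
proof -
  obtain j where j: "n = Suc j" using n by (cases n) auto
  obtain m where m: "c - frag_cmul m z \<in> mod_relboundary_set p n X A"
    using mod_cycle_generated [OF c(1)] by blast
  let ?B = "mod_boundary_set p j (subtopology X A)"
  have B: "add_subgroup ?B" by (rule add_subgroup_mod_boundary_set)
  have dz: "singular_chain j (subtopology X A) (chain_boundary n z)"
    using boundary_z_chain j by simp
  have m_dz: "frag_cmul m (chain_boundary n z) \<in> ?B"
  proof -
    obtain d where d: "singular_chain j X d" "chain_boundary n c = frag_cmul (int p) d"
      using c(1) j by (auto simp: mod_cycle_set_def)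
    \<comment> \<open>The chain of \<open>A\<close> is here 0, written as
      \<open>\<partial>c - p d\<close>. As \<open>c\<close> and \<open>m z\<close> have the same
      relative class, \<open>\<partial>(m z)\<close> bounds modulo p in \<open>A\<close>.\<close>
    have "0 - frag_cmul m (chain_boundary n z) \<in> ?B"
    proof (rule mod_boundary_in_subspace)
      show "singular_chain j X (- d)" using d by (simp add: singular_chain_minus)
      show "0 = chain_boundary (Suc j) c + frag_cmul (int p) (- d)"
        using d j by (simp add: poly_mapping_eqI lookup_add)
      show "c - frag_cmul m z \<in> mod_relboundary_set p (Suc j) X A" using m j by simp
    qed (use dz j in \<open>simp_all add: singular_chain_cmul chain_boundary_cmul\<close>)
    then show ?thesis using add_subgroup_minus [OF B] by force
  qed
  have p_dz: "frag_cmul (int p) (chain_boundary n z) \<in> ?B"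
    by (rule cmul_in_mod_boundary_set [OF dvd_refl dz])
  have "\<not> int p dvd m"
  proof
    assume "int p dvd m"
    then have "frag_cmul m z \<in> mod_relboundary_set p n X A"
      using cmul_in_mod_boundary_set z_chain mod_boundary_subset_relboundary by blast
    then have "c - frag_cmul m z + frag_cmul m z \<in> mod_relboundary_set p n X A"
      by (rule add_subgroup_add [OF add_subgroup_mod_relboundary_set m])
    then show False using c by simp
  qed
  then show ?thesis using cmul_coprime_in_subgroup [OF B p p_dz m_dz] j by simp
qed

text \<open>In the tower \<open>?B \<le> ?M \<le> ?Z\<close>, \<open>?M\<close> consists of the
  cycles with zero relative class. \<open>?Z / ?M\<close> is the image in H_n(X, A) = Z/p, all of it
  because \<open>z\<close> lifts; \<open>?M / ?B\<close> is the image of H_n(A), which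
  injects.\<close>

lemma mod_homology_card_top_lifted:
  assumes "n = 0 \<or> chain_boundary n z \<in> mod_boundary_set p (n - 1) (subtopology X A)"
  shows "mod_homology_card p n X = p * mod_homology_card p n (subtopology X A)"
proof -
  let ?Z = "mod_cycle_set p n X" and ?B = "mod_boundary_set p n X"
    and ?R = "mod_relboundary_set p n X A"
  let ?M = "?Z \<inter> ?R"
  obtain z' a where z': "z' \<in> ?Z" and a: "singular_chain n (subtopology X A) a" "z' = z - a"
    using lift_z_to_cycle [OF assms] by blast
  have M: "add_subgroup ?M"
    by (intro add_subgroup_Int add_subgroup_mod_cycle_set add_subgroup_mod_relboundary_set)
  \<comment> \<open>\<open>z\<close> and its lift \<open>z'\<close> differ by a chain of
    \<open>A\<close>, so they are interchangeable in tests for membership in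
    \<open>?R\<close>.\<close>
  have "frag_cmul m a \<in> ?R" for m
    using singular_relboundary_in_mod_relboundary_set singular_chain_imp_relboundary
      singular_chain_cmul a by blast
  moreover have "frag_cmul m z' = frag_cmul m z - frag_cmul m a" for m
    by (simp only: a frag_cmul_diff2)
  ultimately have z'_iff: "c + frag_cmul m z' \<in> ?R \<longleftrightarrow> c + frag_cmul m z \<in> ?R" for m c
    using add_subgroup_diff [OF add_subgroup_mod_relboundary_set, of "c + frag_cmul m z" p n X A]
      add_subgroup_add [OF add_subgroup_mod_relboundary_set, of "c + frag_cmul m z'" p n X A]
    by (metis (no_types, lifting) add_diff_eq diff_add_cancel)
  have "mod_homology_card p n X = card (coset ?M ` ?Z) * card (coset ?B ` ?M)"
    unfolding mod_homology_card_def
    by (rule card_coset_mult)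
      (use mod_boundary_subset_cycle [of p n X] mod_boundary_subset_relboundary [of p n X A]
        in \<open>auto simp: M add_subgroup_mod_boundary_set add_subgroup_mod_cycle_set\<close>)
  also have "card (coset ?M ` ?Z) = p"
  proof (rule card_coset_cyclic [OF M add_subgroup_mod_cycle_set z'])
    fix c assume c: "c \<in> ?Z"
    then obtain m where "c - frag_cmul m z \<in> ?R" using mod_cycle_generated by blast
    then have "c - frag_cmul m z' \<in> ?R" using z'_iff [of c "- m"] by (simp only: add_frag_cmul_uminus)
    moreover have "c - frag_cmul m z' \<in> ?Z"
      by (intro add_subgroup_diff frag_cmul_in_subgroup add_subgroup_mod_cycle_set c z')
    ultimately show "\<exists>m. c - frag_cmul m z' \<in> ?M" by blast
  next
    fix m
    have "frag_cmul m z' \<in> ?Z" by (intro frag_cmul_in_subgroup add_subgroup_mod_cycle_set z')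
    moreover have "frag_cmul m z \<in> ?R \<longleftrightarrow> int p dvd m"
    proof
      assume "int p dvd m"
      then show "frag_cmul m z \<in> ?R"
        using cmul_in_mod_boundary_set z_chain mod_boundary_subset_relboundary by blast
    qed (rule cmul_z_mod_relboundary)
    ultimately show "frag_cmul m z' \<in> ?M \<longleftrightarrow> int p dvd m" using z'_iff [of 0 m] by simp
  qed (rule p_pos)
  also have "card (coset ?B ` ?M) = mod_homology_card p n (subtopology X A)"
    unfolding mod_homology_card_def
  proof (rule card_coset_second_iso)
    show "mod_cycle_set p n (subtopology X A) \<subseteq> ?M"
    proof
      fix c assume c: "c \<in> mod_cycle_set p n (subtopology X A)"
      then have "singular_chain n (subtopology X A) c" by (simp add: mod_cycle_set_def)
      then show "c \<in> ?M"
        using c mod_cycle_set_mono singular_relboundary_in_mod_relboundary_set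
          singular_chain_imp_relboundary by blast
    qed
    show "\<exists>y\<in>mod_cycle_set p n (subtopology X A). x - y \<in> ?B" if "x \<in> ?M" for x
      using that mod_cycle_relboundary_decompose [OF p_pos] by blast
    show "x - y \<in> ?B \<longleftrightarrow> x - y \<in> mod_boundary_set p n (subtopology X A)"
      if "x \<in> mod_cycle_set p n (subtopology X A)" "y \<in> mod_cycle_set p n (subtopology X A)" for x y
      using that mod_boundary_set_subtopology [of n "x - y"] mod_boundary_set_mono [of p n X A]
      by (auto simp: mod_cycle_set_def singular_chain_diff)
  qed (simp_all add: add_subgroup_mod_boundary_set)
  finally show ?thesis .
qed

text \<open>By \<open>boundary_z_bounds\<close> no cycle modulo p has a nonzero relative class, so
  H_n(A) -> H_n(X) is onto; it is injective in any case.\<close>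

lemma mod_homology_card_top_unlifted:
  assumes n: "n > 0" and "chain_boundary n z \<notin> mod_boundary_set p (n - 1) (subtopology X A)"
  shows "mod_homology_card p n X = mod_homology_card p n (subtopology X A)"
  unfolding mod_homology_card_def
proof (rule card_coset_second_iso)
  show "\<exists>y\<in>mod_cycle_set p n (subtopology X A). x - y \<in> mod_boundary_set p n X"
    if "x \<in> mod_cycle_set p n X" for x
    using that mod_cycle_relboundary_decompose [OF p_pos] boundary_z_bounds assms by blast
  show "x - y \<in> mod_boundary_set p n X \<longleftrightarrow> x - y \<in> mod_boundary_set p n (subtopology X A)"
    if "x \<in> mod_cycle_set p n (subtopology X A)" "y \<in> mod_cycle_set p n (subtopology X A)" for x y
    using that mod_boundary_set_subtopology [of n "x - y"] mod_boundary_set_mono [of p n X A]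
    by (auto simp: mod_cycle_set_def singular_chain_diff)
qed (simp_all add: add_subgroup_mod_boundary_set mod_cycle_set_mono)

text \<open>H_k(X, A) vanishes, so H_k(A) -> H_k(X) is onto. Its kernel \<open>?M / ?B\<close> is
  generated by the class of \<open>\<partial>z\<close>, which p kills, so it has order 1 or
  p.\<close>

lemma mod_homology_card_below:
  assumes k: "Suc k = n"
  shows "mod_homology_card p k (subtopology X A) =
    (if chain_boundary n z \<in> mod_boundary_set p k (subtopology X A) then 1 else p)
      * mod_homology_card p k X"
proof -
  let ?Z = "mod_cycle_set p k (subtopology X A)" and ?B = "mod_boundary_set p k (subtopology X A)"
  let ?M = "?Z \<inter> mod_boundary_set p k X" and ?w = "chain_boundary n z"
  have B: "add_subgroup ?B" by (rule add_subgroup_mod_boundary_set)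
  have M: "add_subgroup ?M"
    by (intro add_subgroup_Int add_subgroup_mod_cycle_set add_subgroup_mod_boundary_set)
  have w_chain: "singular_chain k (subtopology X A) ?w" using boundary_z_chain k by auto
  have "?w \<in> mod_boundary_set p k X"
    using chain_boundary_in_mod_boundary_set [of k X z] z_chain k by simp
  then have w: "?w \<in> ?M" using boundary_z_cycle k by auto
  have gen: "\<exists>m. c - frag_cmul m ?w \<in> ?B" if c: "c \<in> ?M" for c
  proof -
    have c_chain: "singular_chain k (subtopology X A) c" using c by (simp add: mod_cycle_set_def)
    obtain e d m where "singular_chain k X d" "c = chain_boundary (Suc k) e + frag_cmul (int p) d"
      "e - frag_cmul m z \<in> mod_relboundary_set p (Suc k) X A"
      using mod_boundary_relcycle [OF c_chain] c k by (metis IntD2)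
    then have "c - frag_cmul m ?w \<in> ?B"
      using mod_boundary_in_subspace [of k c "frag_cmul m ?w" d e "frag_cmul m z"] c_chain w_chain k
      by (simp add: singular_chain_cmul chain_boundary_cmul)
    then show ?thesis by blast
  qed
  have "mod_homology_card p k (subtopology X A) = card (coset ?M ` ?Z) * card (coset ?B ` ?M)"
    unfolding mod_homology_card_def
    by (rule card_coset_mult)
      (use mod_boundary_subset_cycle [of p k "subtopology X A"] mod_boundary_set_mono [of p k X A]
        in \<open>auto simp: M add_subgroup_mod_boundary_set add_subgroup_mod_cycle_set\<close>)
  also have "card (coset ?M ` ?Z) = mod_homology_card p k X"
    unfolding mod_homology_card_def
  proof (rule card_coset_second_iso [symmetric])
    show "\<exists>y\<in>?Z. x - y \<in> mod_boundary_set p k X" if "x \<in> mod_cycle_set p k X" for x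
      using that k by (intro mod_cycle_relboundary_decompose p_pos mod_cycle_other_degree) auto
    show "x - y \<in> mod_boundary_set p k X \<longleftrightarrow> x - y \<in> ?M" if "x \<in> ?Z" "y \<in> ?Z" for x y
      using add_subgroup_diff [OF add_subgroup_mod_cycle_set that] by simp
  qed (simp_all add: add_subgroup_mod_boundary_set M mod_cycle_set_mono)
  also have "card (coset ?B ` ?M) = (if ?w \<in> ?B then 1 else p)"
  proof (cases "?w \<in> ?B")
    case True
    have "coset ?B c = coset ?B 0" if c: "c \<in> ?M" for c
    proof -
      obtain m where "c - frag_cmul m ?w \<in> ?B" using gen [OF c] by blast
      from add_subgroup_add [OF B this frag_cmul_in_subgroup [OF B True, of m]]
      show ?thesis by (simp add: coset_eq_iff B)
    qed
    then have "coset ?B ` ?M = {coset ?B 0}" using add_subgroup_zero [OF M] by blast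
    then show ?thesis using True by simp
  next
    case False
    have "card (coset ?B ` ?M) = p"
    proof (rule card_coset_cyclic [OF B M w gen])
      show "frag_cmul m ?w \<in> ?B \<longleftrightarrow> int p dvd m" for m
      proof
        assume "int p dvd m"
        then show "frag_cmul m ?w \<in> ?B" using w_chain by (rule cmul_in_mod_boundary_set)
      next
        assume m: "frag_cmul m ?w \<in> ?B"
        then show "int p dvd m"
          using cmul_coprime_in_subgroup [OF B p, of ?w m] False w_chain
            cmul_in_mod_boundary_set [OF dvd_refl w_chain] by blast
      qed
    qed (use p_pos in auto)
    then show ?thesis using False by simp
  qed
  finally show ?thesis by simp
qed

end

text \<open>Here \<open>e\<close> is the Euler characteristic with coefficients in \<open>\<int>/p\<int>\<close>, and \<open>d k\<close> the Betti numbers.\<close>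

definition has_mod_euler_char :: "nat \<Rightarrow> 'a topology \<Rightarrow> int \<Rightarrow> bool" where
  "has_mod_euler_char p X e \<longleftrightarrow>
     (\<exists>d :: nat \<Rightarrow> nat. (\<forall>k. mod_homology_card p k X = p ^ d k) \<and> finite {k. d k \<noteq> 0} \<and>
        e = (\<Sum>k | d k \<noteq> 0. (-1) ^ k * int (d k)))"

lemma alternating_sum_update:
  fixes d :: "nat \<Rightarrow> nat"
  assumes "finite {k. d k \<noteq> 0}" "d' = d(n := v)"
  shows "finite {k. d' k \<noteq> 0}"
    "(\<Sum>k | d' k \<noteq> 0. (-1) ^ k * int (d' k))
      = (\<Sum>k | d k \<noteq> 0. (-1) ^ k * int (d k)) + (-1) ^ n * (int v - int (d n))"
proof -
  let ?S = "insert n {k. d k \<noteq> 0}"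
  have sub: "{k. d' k \<noteq> 0} \<subseteq> ?S" using assms(2) by (auto split: if_splits)
  then show "finite {k. d' k \<noteq> 0}" using assms(1) finite_subset by blast
  have "(\<Sum>k | d' k \<noteq> 0. (-1) ^ k * int (d' k)) = (\<Sum>k\<in>?S. (-1) ^ k * int (d' k))"
    using assms(1) sub by (intro sum.mono_neutral_left) auto
  also have "\<dots> = (\<Sum>k\<in>?S. (-1) ^ k * int (d k) + (if k = n then (-1) ^ n * (int v - int (d n)) else 0))"
    using assms(2) by (intro sum.cong) (auto simp: algebra_simps)
  also have "\<dots> = (\<Sum>k\<in>?S. (-1) ^ k * int (d k)) + (-1) ^ n * (int v - int (d n))"
    using assms(1) by (simp add: sum.distrib)
  also have "(\<Sum>k\<in>?S. (-1) ^ k * int (d k)) = (\<Sum>k | d k \<noteq> 0. (-1) ^ k * int (d k))"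
    using assms(1) by (intro sum.mono_neutral_right) auto
  finally show "(\<Sum>k | d' k \<noteq> 0. (-1) ^ k * int (d' k))
      = (\<Sum>k | d k \<noteq> 0. (-1) ^ k * int (d k)) + (-1) ^ n * (int v - int (d n))" .
qed

text \<open>Signs in adjacent degrees are opposite, so raising the exponent in degree
  \<open>n\<close> and lowering the one in degree \<open>n - 1\<close> change the alternating sum by
  the same amount.\<close>

lemma has_mod_euler_char_rel_cell:
  assumes rc: "rel_cell n X A z" and p: "prime p" and "has_mod_euler_char p (subtopology X A) e"
  shows "has_mod_euler_char p X (e + (-1) ^ n)"
proof -
  obtain d where card: "\<And>k. mod_homology_card p k (subtopology X A) = p ^ d k"
    and fin: "finite {k. d k \<noteq> 0}" and e: "e = (\<Sum>k | d k \<noteq> 0. (-1) ^ k * int (d k))"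
    using assms(3) unfolding has_mod_euler_char_def by blast
  note other = mod_homology_card_other_degree [OF rc p]
  have p0: "p > 0" using p by (rule prime_gt_0_nat)
  let ?lift = "n = 0 \<or> chain_boundary n z \<in> mod_boundary_set p (n - 1) (subtopology X A)"
  show ?thesis
  proof (cases ?lift)
    case True
    define d' where "d' = d(n := Suc (d n))"
    have "mod_homology_card p k X = p ^ d' k" for k
    proof -
      consider "k = n" | "Suc k = n" | "k \<noteq> n" "Suc k \<noteq> n" by blast
      then show ?thesis
      proof cases
        case 1
        then show ?thesis using mod_homology_card_top_lifted [OF rc p True] by (simp add: card d'_def)
      next
        case 2
        then show ?thesis
          using mod_homology_card_below [OF rc p 2] True by (auto simp: card d'_def)
      next
        case 3
        then show ?thesis using other [OF 3] by (simp add: card d'_def)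
      qed
    qed
    then show ?thesis
      unfolding has_mod_euler_char_def using alternating_sum_update [OF fin d'_def] e
      by (intro exI [of _ d']) simp
  next
    case False
    then obtain j where j: "n = Suc j" by (cases n) auto
    have below: "p ^ d j = p * mod_homology_card p j X"
      using mod_homology_card_below [OF rc p, of j] False j by (simp add: card)
    \<comment> \<open>The order \<open>p ^ d j\<close> is a multiple of p, hence not 1, which leaves
      room for lowering the exponent.\<close>
    have "d j > 0"
    proof (rule ccontr)
      assume "\<not> d j > 0"
      then have "p * mod_homology_card p j X = 1" using below by (metis gr0I power_0)
      then have "p = 1" by (metis nat_mult_eq_1_iff)
      then show False using p by simp
    qed
    then obtain i where i: "d j = Suc i" by (cases "d j") auto
    define d' where "d' = d(j := i)"
    have "mod_homology_card p k X = p ^ d' k" for k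
    proof -
      consider "k = n" | "k = j" | "k \<noteq> n" "Suc k \<noteq> n" using j by blast
      then show ?thesis
      proof cases
        case 1
        then show ?thesis
          using mod_homology_card_top_unlifted [OF rc p] False j by (simp add: card d'_def)
      next
        case 2
        then show ?thesis using below i p0 by (simp add: d'_def)
      next
        case 3
        then show ?thesis using other [OF 3] j by (auto simp add: card d'_def)
      qed
    qed
    then show ?thesis
      unfolding has_mod_euler_char_def using alternating_sum_update [OF fin d'_def] e i j
      by (intro exI [of _ d']) simp
  qed
qed

section \<open>The relative homology of a cell attachment\<close>

definition disk_norm :: "nat \<Rightarrow> (nat \<Rightarrow> real) \<Rightarrow> real" where
  "disk_norm n z = sqrt (\<Sum>i<n. z i ^ 2)"

lemma disk_norm_nonneg: "disk_norm n z \<ge> 0"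
  by (simp add: disk_norm_def sum_nonneg)

lemma disk_norm_scale: "c \<ge> 0 \<Longrightarrow> disk_norm n (\<lambda>i. c * z i) = c * disk_norm n z"
  by (simp add: disk_norm_def power_mult_distrib real_sqrt_mult flip: sum_distrib_left)

lemma sum_squares_le_1_iff: "(\<Sum>i<n. z i ^ 2) \<le> 1 \<longleftrightarrow> disk_norm n z \<le> 1"
  and sum_squares_eq_1_iff: "(\<Sum>i<n. z i ^ 2) = 1 \<longleftrightarrow> disk_norm n z = 1"
  by (simp_all add: disk_norm_def)

lemma topspace_disk: "topspace (disk n) = {z. (\<forall>i\<ge>n. z i = 0) \<and> disk_norm n z \<le> 1}"
  by (auto simp: disk_def topspace_Euclidean_space sum_squares_le_1_iff)

lemma disk_eq_top_of_set: "disk n = top_of_set (topspace (disk n))"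
  by (simp add: topspace_disk disk_def Euclidean_space_def subtopology_subtopology
      sum_squares_le_1_iff Collect_conj_eq euclidean_product_topology)

lemma continuous_on_disk_norm:
  "continuous_on S f \<Longrightarrow> continuous_on S (\<lambda>x. disk_norm n (f x))"
  unfolding disk_norm_def
  by (intro continuous_on_real_sqrt continuous_on_sum continuous_on_power)
    (rule continuous_on_product_then_coordinatewise)

lemma Hausdorff_space_disk: "Hausdorff_space (disk n)"
  unfolding disk_def by (intro Hausdorff_space_subtopology Hausdorff_Euclidean_space)

text \<open>The disk sits in a countable power of the reals, as a closed subset of the power of
  \<open>[-1, 1]\<close>, which is compact by Tychonoff.\<close>

lemma compact_space_disk: "compact_space (disk n)"
proof -
  let ?K = "UNIV \<rightarrow>\<^sub>E {-1..1::real} :: (nat \<Rightarrow> real) set"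
  have "compactin (powertop_real UNIV) ?K"
    by (simp add: compactin_PiE)
  moreover have "closed {z :: nat \<Rightarrow> real. (\<forall>i\<ge>n. z i = 0) \<and> disk_norm n z \<le> 1}"
    by (intro closed_Collect_conj closed_Collect_all closed_Collect_imp closed_Collect_eq
        closed_Collect_le continuous_on_const continuous_on_product_coordinates
        continuous_on_disk_norm continuous_on_id) auto
  moreover have "{z. (\<forall>i\<ge>n. z i = 0) \<and> disk_norm n z \<le> 1} \<subseteq> ?K"
  proof (clarsimp simp: PiE_def)
    fix z :: "nat \<Rightarrow> real" and i
    assume z: "\<forall>i\<ge>n. z i = 0" "disk_norm n z \<le> 1"
    have "z i ^ 2 \<le> 1"
    proof (cases "i < n")
      case True
      then have "z i ^ 2 \<le> (\<Sum>i<n. z i ^ 2)" by (intro member_le_sum) auto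
      then show ?thesis using z(2) by (simp add: disk_norm_def)
    qed (use z in simp)
    then show "- 1 \<le> z i \<and> z i \<le> 1"
      by (simp add: abs_square_le_1 abs_le_iff)
  qed
  ultimately have "compactin (powertop_real UNIV) (topspace (disk n))"
    by (metis closed_closedin closed_compactin euclidean_product_topology topspace_disk)
  then show ?thesis
    by (metis compact_space_subtopology disk_eq_top_of_set euclidean_product_topology)
qed

lemma zero_in_disk: "(\<lambda>i. 0) \<in> topspace (disk n)"
  by (simp add: topspace_disk disk_norm_def)

definition open_cell :: "nat \<Rightarrow> (nat \<Rightarrow> real) set" where
  "open_cell n = {z \<in> topspace (disk n). disk_norm n z < 1}"

definition cell_boundary :: "nat \<Rightarrow> (nat \<Rightarrow> real) set" where
  "cell_boundary n = {z \<in> topspace (disk n). disk_norm n z = 1}"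

lemma topspace_disk_eq: "topspace (disk n) = open_cell n \<union> cell_boundary n"
  by (auto simp: open_cell_def cell_boundary_def topspace_disk)

lemma cell_boundary_Suc: "cell_boundary (Suc n) = topspace (nsphere n)"
  unfolding cell_boundary_def topspace_disk
  by (auto simp: nsphere_def topspace_Euclidean_space sum_squares_eq_1_iff lessThan_Suc_atMost
      disk_norm_def Suc_le_eq)

text \<open>\<open>disk_norm 0\<close> is an empty sum, so the only point of \<open>disk 0\<close>
  is interior and a 0-cell is attached along nothing.\<close>

lemma cell_boundary_0: "cell_boundary 0 = {}"
  by (simp add: cell_boundary_def disk_norm_def)

lemma topspace_disk_0: "topspace (disk 0) = {\<lambda>i. 0}"
  by (auto simp: topspace_disk disk_norm_def)

lemma contractible_space_disk: "contractible_space (disk n)"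
proof -
  have "continuous_on ({0..1::real} \<times> topspace (disk n)) (\<lambda>x i. (1 - fst x) * snd x i)"
    by (intro continuous_on_coordinatewise_then_product continuous_on_mult continuous_on_diff
        continuous_on_const continuous_on_fst continuous_on_id
        continuous_on_product_then_coordinatewise [OF continuous_on_snd])
  moreover have "(\<lambda>i. (1 - t) * z i) \<in> topspace (disk n)" if "t \<in> {0..1}" "z \<in> topspace (disk n)" for t z
    using that mult_mono [of "1 - t" 1 "disk_norm n z" 1]
    by (auto simp: topspace_disk disk_norm_scale disk_norm_nonneg)
  ultimately have "homotopic_with (\<lambda>x. True) (disk n) (disk n) id (\<lambda>z i. 0)"
    unfolding homotopic_with_def
    by (intro exI [of _ "\<lambda>x i. (1 - fst x) * snd x i"])
      (subst (1 2) disk_eq_top_of_set, auto simp: Pi_iff)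
  then show ?thesis unfolding contractible_space_def by blast
qed

text \<open>The disk is contractible, so the reduced homology of the sphere is shifted up by one
  degree. For \<open>n = 0\<close> the pair is a point and the empty set.\<close>

lemma homology_disk_boundary:
  "relative_homology_group (int n) (disk n) (cell_boundary n) \<cong> integer_group"
  "k \<noteq> int n \<Longrightarrow> trivial_group (relative_homology_group k (disk n) (cell_boundary n))"
proof -
  have "relative_homology_group (int n) (disk n) (cell_boundary n) \<cong> integer_group \<and>
    (k \<noteq> int n \<longrightarrow> trivial_group (relative_homology_group k (disk n) (cell_boundary n)))"
  proof (cases n)
    case 0
    then show ?thesis
      using homology_coefficients [OF topspace_disk_0] homology_dimension_axiom [OF topspace_disk_0]
      by (simp add: cell_boundary_0)
  next
    case (Suc m)
    have sphere: "subtopology (disk n) (cell_boundary n) = nsphere m"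
    proof -
      have "nsphere m = top_of_set (topspace (nsphere m))"
        by (simp add: nsphere euclidean_product_topology)
      moreover have "subtopology (disk n) (cell_boundary n) = top_of_set (cell_boundary n)"
        by (subst disk_eq_top_of_set)
          (simp add: subtopology_subtopology cell_boundary_def Int_absorb1 Collect_conj_eq)
      ultimately show ?thesis by (simp add: Suc cell_boundary_Suc)
    qed
    have "relative_homology_group j (disk n) (cell_boundary n) \<cong> reduced_homology_group (j - 1) (nsphere m)" for j
    proof -
      have "topspace (disk n) \<inter> cell_boundary n \<noteq> {}"
        using in_topspace_nsphere [of m] topspace_disk_eq [of n] cell_boundary_Suc [of m] Suc by blast
      from isomorphic_group_relative_homology_of_contractible [OF contractible_space_disk this]
      show ?thesis unfolding sphere .
    qed
    then show ?thesis
      using reduced_homology_group_nsphere [of m] reduced_homology_group_nsphere(2) [of "k - 1" m] Suc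
      by (metis (no_types, opaque_lifting) add_diff_cancel_right' diff_add_cancel group_reduced_homology_group
          group_relative_homology_group isomorphic_group_triviality iso_trans of_nat_Suc add.commute)
  qed
  then show "relative_homology_group (int n) (disk n) (cell_boundary n) \<cong> integer_group"
    "k \<noteq> int n \<Longrightarrow> trivial_group (relative_homology_group k (disk n) (cell_boundary n))"
    by blast+
qed

text \<open>Dilation by \<open>1 + t\<close>, cut off radially at the unit sphere; the
  \<open>max\<close> also keeps the denominator positive. At \<open>t = 1\<close> exactly the points
  of norm at least 1/2 reach the sphere, whence the radius 1/2 of the collar.\<close>

definition stretch :: "nat \<Rightarrow> real \<Rightarrow> (nat \<Rightarrow> real) \<Rightarrow> nat \<Rightarrow> real" where
  "stretch n t z = (\<lambda>i. (1 + t) / max 1 ((1 + t) * disk_norm n z) * z i)"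

lemma disk_norm_stretch:
  "t \<ge> 0 \<Longrightarrow> disk_norm n (stretch n t z) = min 1 ((1 + t) * disk_norm n z)"
  unfolding stretch_def
  by (subst disk_norm_scale) (auto simp: max_def min_def divide_simps)

lemma stretch_in_disk: "t \<ge> 0 \<Longrightarrow> z \<in> topspace (disk n) \<Longrightarrow> stretch n t z \<in> topspace (disk n)"
  unfolding topspace_disk using disk_norm_stretch [of t n z] by (auto simp: stretch_def)

lemma stretch_0: "z \<in> topspace (disk n) \<Longrightarrow> stretch n 0 z = z"
  by (auto simp: stretch_def topspace_disk max_def)

lemma stretch_boundary: "t \<ge> 0 \<Longrightarrow> disk_norm n z = 1 \<Longrightarrow> stretch n t z = z"
  by (auto simp: stretch_def max_def)

lemma continuous_map_stretch:
  "continuous_map (prod_topology (top_of_set {0..1}) (disk n)) (disk n) (\<lambda>(t, z). stretch n t z)"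
proof -
  have "continuous_on ({0..1::real} \<times> topspace (disk n)) (\<lambda>(t, z). stretch n t z)"
    unfolding stretch_def case_prod_beta
    by (intro continuous_on_coordinatewise_then_product continuous_on_mult continuous_on_divide
        continuous_on_max continuous_on_add continuous_on_const continuous_on_fst continuous_on_id
        continuous_on_disk_norm continuous_on_snd
        continuous_on_product_then_coordinatewise [OF continuous_on_snd]) auto
  then show ?thesis
    by (subst (1 2) disk_eq_top_of_set) (auto simp: Pi_iff stretch_in_disk)
qed

text \<open>One \<open>n\<close>-cell attached to \<open>A\<close>. The topology of the attachment
  is encoded by compactness and the Hausdorff property: they make \<phi> a closed map, so a function
  on the closed cell is continuous as soon as its pullback to the disk is.\<close>

locale cell_attachment =
  fixes n :: nat and X :: "'x topology" and A :: "'x set" and \<phi> :: "(nat \<Rightarrow> real) \<Rightarrow> 'x"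
  assumes compact: "compact_space X" and Hausdorff: "Hausdorff_space X"
    and closed_A: "closedin X A"
    and cont: "continuous_map (disk n) X \<phi>"
    and boundary: "\<phi> ` cell_boundary n \<subseteq> A"
    and inj: "inj_on \<phi> (open_cell n)"
    and disjoint: "\<phi> ` open_cell n \<inter> A = {}"
    and cover: "topspace X = A \<union> \<phi> ` topspace (disk n)"
begin

text \<open>A homotopy from the identity that moves the points of the cell radially outwards; at time 1
  the outer half of the cell has reached \<open>A\<close>.\<close>

definition push :: "real \<times> 'x \<Rightarrow> 'x" where
  "push = (\<lambda>(t, x). if x \<in> \<phi> ` open_cell n then \<phi> (stretch n t (inv_into (open_cell n) \<phi> x)) else x)"

lemma push_A: "x \<in> A \<Longrightarrow> push (t, x) = x"
  using disjoint by (auto simp: push_def)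

text \<open>On the boundary sphere both sides reduce to \<open>\<phi> z\<close>, as
  \<open>stretch\<close> fixes the sphere and \<open>push\<close> fixes \<open>A\<close>. So the
  formula holds on the closed disk, as needed for descending to its image.\<close>

lemma push_cell:
  assumes "z \<in> topspace (disk n)" "t \<ge> 0" shows "push (t, \<phi> z) = \<phi> (stretch n t z)"
proof (cases "z \<in> open_cell n")
  case True
  then show ?thesis by (simp add: push_def inj)
next
  case False
  then have "z \<in> cell_boundary n" using assms topspace_disk_eq by blast
  moreover from this have "\<phi> z \<in> A" using boundary by blast
  ultimately show ?thesis using assms by (simp add: push_A stretch_boundary cell_boundary_def)
qed

lemma closed_map_cell: "closed_map (disk n) X \<phi>"
  by (rule continuous_imp_closed_map [OF cont compact_space_disk Hausdorff])

lemma closed_image: "closedin (disk n) S \<Longrightarrow> closedin X (\<phi> ` S)"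
  using closed_map_cell by (simp add: closed_map_def)

text \<open>Pasting over two closed pieces. On \<open>A\<close> the homotopy is constant in time. On
  the closed cell it is induced from \<open>\<phi> \<circ> stretch\<close>, because the product of
  the interval with \<phi> maps a compact space onto a Hausdorff one and is thus a quotient
  map.\<close>

lemma continuous_map_push:
  "continuous_map (prod_topology (top_of_set {0..1}) X) X push"
proof -
  let ?I = "top_of_set {0..1::real}" and ?C = "\<phi> ` topspace (disk n)"
  have C: "closedin X ?C" by (rule closed_image) simp
  have on_A: "continuous_map (subtopology (prod_topology ?I X) ({0..1} \<times> A)) X push"
  proof (rule continuous_map_eq)
    show "continuous_map (subtopology (prod_topology ?I X) ({0..1} \<times> A)) X snd"
      by (intro continuous_map_from_subtopology continuous_map_snd)
  qed (auto simp: push_A)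
  have on_C: "continuous_map (subtopology (prod_topology ?I X) ({0..1} \<times> ?C)) X push"
  proof -
    let ?q = "\<lambda>(t :: real, z). (t, \<phi> z)"
    have eq: "subtopology (prod_topology ?I X) ({0..1} \<times> ?C) = prod_topology ?I (subtopology X ?C)"
      by (simp add: prod_topology_subtopology(2) prod_topology_subtopology(1) subtopology_subtopology
          Times_Int_Times)
    have "continuous_map (prod_topology ?I (disk n)) (prod_topology ?I (subtopology X ?C)) ?q"
      using cont by (auto simp: continuous_map_prod_top continuous_map_in_subtopology)
    then have q: "quotient_map (prod_topology ?I (disk n)) (prod_topology ?I (subtopology X ?C)) ?q"
    proof (rule continuous_imp_quotient_map)
      show "compact_space (prod_topology ?I (disk n))"
        by (simp add: compact_space_prod_topology compact_space_disk compact_space_subtopology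
            compactin_euclidean_iff)
      show "Hausdorff_space (prod_topology ?I (subtopology X ?C))"
        by (simp add: Hausdorff_space_prod_topology Hausdorff Hausdorff_space_subtopology)
      show "?q ` topspace (prod_topology ?I (disk n)) = topspace (prod_topology ?I (subtopology X ?C))"
        using closedin_subset [OF C] by force
    qed
    have "continuous_map (prod_topology ?I (disk n)) X (\<phi> \<circ> (\<lambda>(t, z). stretch n t z))"
      by (rule continuous_map_compose [OF continuous_map_stretch cont])
    then have "continuous_map (prod_topology ?I (disk n)) X (push \<circ> ?q)"
      by (rule continuous_map_eq) (auto simp: push_cell)
    then show ?thesis
      unfolding eq by (rule continuous_compose_quotient_map [OF q])
  qed
  show ?thesis
  proof (rule pasting_lemma_closed [where I = "{A, ?C}" and T = "\<lambda>S. {0..1} \<times> S" and f = "\<lambda>_. push"])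
    show "closedin (prod_topology ?I X) ({0..1} \<times> S)" if "S \<in> {A, ?C}" for S
      using that closed_A C by (auto simp: closedin_prod_Times_iff)
    show "continuous_map (subtopology (prod_topology ?I X) ({0..1} \<times> S)) X push" if "S \<in> {A, ?C}" for S
      using that on_A on_C by blast
    show "\<exists>S. S \<in> {A, ?C} \<and> x \<in> {0..1} \<times> S \<and> push x = push x"
      if "x \<in> topspace (prod_topology ?I X)" for x
      using that cover by (cases x) auto
  qed auto
qed

section \<open>A collar of the subspace, and excision\<close>

definition collar :: "'x set" where
  "collar = A \<union> \<phi> ` {z \<in> topspace (disk n). disk_norm n z \<ge> 1/2}"

text \<open>Points of norm below 1/2 are interior, so their images avoid \<open>A\<close> and have
  only one preimage in the disk.\<close>

lemma collar_eq: "collar = topspace X - \<phi> ` {z \<in> topspace (disk n). disk_norm n z < 1/2}"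
proof -
  have *: "\<phi> z \<notin> A" "\<phi> z = \<phi> w \<longleftrightarrow> z = w"
    if "z \<in> topspace (disk n)" "disk_norm n z < 1/2" "w \<in> topspace (disk n)" for z w
  proof -
    have z: "z \<in> open_cell n" using that by (simp add: open_cell_def)
    then show "\<phi> z \<notin> A" using disjoint by blast
    then show "\<phi> z = \<phi> w \<longleftrightarrow> z = w"
      using z that(3) boundary inj topspace_disk_eq [of n] by (auto dest: inj_onD)
  qed
  then show ?thesis
    unfolding collar_def cover by (fastforce simp: not_less)
qed

lemma push_image:
  assumes "t \<in> {0..1}"
  shows "x \<in> A \<Longrightarrow> push (t, x) \<in> A"
    and "x \<in> collar \<Longrightarrow> push (t, x) \<in> collar"
    and "x \<in> collar \<Longrightarrow> t = 1 \<Longrightarrow> push (t, x) \<in> A"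
proof -
  show "push (t, x) \<in> A" if "x \<in> A" using that by (simp add: push_A)
  have half: "min 1 ((1 + t) * r) \<ge> 1/2" if "r \<ge> 1/2" for r :: real
    using assms that mult_mono [of 1 "1 + t" "1/2" r] by auto
  have "stretch n t z \<in> {z \<in> topspace (disk n). disk_norm n z \<ge> 1/2}"
    if "z \<in> {z \<in> topspace (disk n). disk_norm n z \<ge> 1/2}" for z
    using that assms half [of "disk_norm n z"]
    by (simp add: stretch_in_disk disk_norm_stretch del: min_less_iff_conj)
  then have "push (t, \<phi> z) \<in> collar" if "z \<in> {z \<in> topspace (disk n). disk_norm n z \<ge> 1/2}" for z
    using that assms unfolding collar_def by (simp add: push_cell)
  then show "push (t, x) \<in> collar" if "x \<in> collar"
    using that push_A [of x t] unfolding collar_def by (elim UnE imageE) simp_all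
  have "push (1, \<phi> z) \<in> A" if "z \<in> topspace (disk n)" "disk_norm n z \<ge> 1/2" for z
  proof -
    have "stretch n 1 z \<in> cell_boundary n"
      using that by (simp add: cell_boundary_def stretch_in_disk disk_norm_stretch)
    then show ?thesis using boundary that by (auto simp: push_cell)
  qed
  then show "push (t, x) \<in> A" if "x \<in> collar" "t = 1"
    using that push_A [of x t] unfolding collar_def by (elim UnE imageE) simp_all
qed

text \<open>The inclusion of pairs and \<open>push\<close> at time 1 are homotopy inverse.
  \<open>push\<close> itself is both homotopies, since it preserves \<open>A\<close> and the collar
  at all times.\<close>

lemma homology_collar: "relative_homology_group k X A \<cong> relative_homology_group k X collar"
proof -
  let ?g = "\<lambda>x. push (1, x)"
  have push_0: "push (0, x) = x" for x
    using stretch_0 topspace_disk_eq [of n]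
    by (auto simp: push_def inv_into_into f_inv_into_f)
  have sub: "continuous_map X X ?g"
    using continuous_map_compose [OF continuous_map_pairedI continuous_map_push, of X "\<lambda>_. 1" id]
    by (auto simp: o_def)
  have hom: "homotopic_with (\<lambda>h. h \<in> S \<rightarrow> S) X X id ?g" if "S = A \<or> S = collar" for S
    unfolding homotopic_with_def
    using continuous_map_push push_0 that push_image(1,2) by (intro exI [of _ push]) auto
  show ?thesis
  proof (rule homotopy_equivalent_space_imp_isomorphic_relative_homology_groups)
    show "id \<in> A \<rightarrow> collar" by (auto simp: collar_def)
    show "?g \<in> collar \<rightarrow> A" using push_image(3) by simp
    show "homotopic_with (\<lambda>h. h \<in> A \<rightarrow> A) X X (?g \<circ> id) id"
      "homotopic_with (\<lambda>h. h \<in> collar \<rightarrow> collar) X X (id \<circ> ?g) id"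
      using hom by (auto simp: homotopic_with_sym)
  qed (use sub in auto)
qed

text \<open>Enlarge \<open>A\<close> to the collar, excise \<open>A\<close>, and pull the rest back
  along \<phi>, a homeomorphism on the open cell. The pair so obtained depends on \<open>n\<close>
  alone.\<close>

lemma homology_open_cell:
  "relative_homology_group k X A
    \<cong> relative_homology_group k (subtopology (disk n) (open_cell n)) {z \<in> open_cell n. disk_norm n z \<ge> 1/2}"
proof -
  let ?D = "subtopology (disk n) (open_cell n)" and ?E = "{z \<in> open_cell n. disk_norm n z \<ge> 1/2}"
  \<comment> \<open>Excision needs an open set between \<open>A\<close> and the collar: the
    complement of the image of the closed disk of radius 1/2.\<close>
  have "X closure_of A \<subseteq> X interior_of collar"
  proof -
    have "closed {z :: nat \<Rightarrow> real. disk_norm n z \<le> 1/2}"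
      by (intro closed_Collect_le continuous_on_disk_norm continuous_on_const continuous_on_id)
    then have "closedin (disk n) {z \<in> topspace (disk n). disk_norm n z \<le> 1/2}"
      by (subst disk_eq_top_of_set) (auto simp: closedin_closed)
    then have "openin X (topspace X - \<phi> ` {z \<in> topspace (disk n). disk_norm n z \<le> 1/2})"
      by (intro openin_diff openin_topspace closed_image)
    moreover have "topspace X - \<phi> ` {z \<in> topspace (disk n). disk_norm n z \<le> 1/2} \<subseteq> collar"
      unfolding collar_eq by force
    moreover have "A \<subseteq> topspace X - \<phi> ` {z \<in> topspace (disk n). disk_norm n z \<le> 1/2}"
      using disjoint closedin_subset [OF closed_A] by (force simp: open_cell_def)
    ultimately have "A \<subseteq> X interior_of collar" by (meson interior_of_maximal subset_trans)
    then show ?thesis using closed_A by (simp add: closure_of_closedin)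
  qed
  moreover have "collar \<subseteq> topspace X" by (auto simp: collar_eq)
  ultimately have "relative_homology_group k (subtopology X (topspace X - A)) (collar - A)
      \<cong> relative_homology_group k (subtopology X (topspace X)) collar"
    by (rule is_isoI [OF homology_excision_axiom])
  then have "relative_homology_group k (subtopology X (topspace X - A)) (collar - A)
      \<cong> relative_homology_group k X collar" by (simp only: subtopology_topspace)
  then have exc: "relative_homology_group k X A
      \<cong> relative_homology_group k (subtopology X (topspace X - A)) (collar - A)"
    by (rule iso_trans [OF homology_collar group.iso_sym [OF group_relative_homology_group]])
  have open_eq: "{z \<in> topspace (disk n). \<phi> z \<in> topspace X - A} = open_cell n"
    using boundary disjoint topspace_disk_eq [of n] cover by auto
  have im: "\<phi> ` open_cell n = topspace X - A"
    using boundary disjoint topspace_disk_eq [of n] cover by auto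
  have "homeomorphic_map ?D (subtopology X (topspace X - A)) \<phi>"
  proof (rule bijective_closed_imp_homeomorphic_map)
    show "closed_map ?D (subtopology X (topspace X - A)) \<phi>"
      by (rule closed_map_restriction [OF closed_map_cell open_eq])
    show "continuous_map ?D (subtopology X (topspace X - A)) \<phi>"
      using cont im by (auto simp: continuous_map_in_subtopology continuous_map_from_subtopology)
    show "\<phi> ` topspace ?D = topspace (subtopology X (topspace X - A))"
      using im by (auto simp: open_cell_def)
    show "inj_on \<phi> (topspace ?D)" using inj by (rule inj_on_subset) auto
  qed
  moreover have "?E \<subseteq> topspace ?D" by (auto simp: open_cell_def)
  moreover have "\<phi> ` ?E = collar - A"
  proof
    show "\<phi> ` ?E \<subseteq> collar - A"
      using disjoint by (auto simp: collar_def open_cell_def)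
    show "collar - A \<subseteq> \<phi> ` ?E"
    proof
      fix x assume x: "x \<in> collar - A"
      then obtain z where z: "z \<in> topspace (disk n)" "disk_norm n z \<ge> 1/2" "x = \<phi> z"
        unfolding collar_def by blast
      with x have "z \<notin> cell_boundary n" using boundary by blast
      then show "x \<in> \<phi> ` ?E" using z topspace_disk_eq [of n] by blast
    qed
  qed
  ultimately have "relative_homology_group k ?D ?E
      \<cong> relative_homology_group k (subtopology X (topspace X - A)) (collar - A)"
    by (rule is_isoI [OF homeomorphic_map_relative_homology_iso])
  then have "relative_homology_group k (subtopology X (topspace X - A)) (collar - A)
      \<cong> relative_homology_group k ?D ?E"
    by (rule group.iso_sym [OF group_relative_homology_group])
  with exc show ?thesis by (rule iso_trans)
qed

end

lemma cell_attachment_disk: "cell_attachment n (disk n) (cell_boundary n) id"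
proof
  have "closed {z :: nat \<Rightarrow> real. disk_norm n z = 1}"
    by (intro closed_Collect_eq continuous_on_disk_norm continuous_on_const continuous_on_id)
  then show "closedin (disk n) (cell_boundary n)"
    by (subst disk_eq_top_of_set) (auto simp: closedin_closed cell_boundary_def)
qed (auto simp: compact_space_disk Hausdorff_space_disk open_cell_def cell_boundary_def)

text \<open>The disk is a cell attached to its own boundary, so \<open>homology_open_cell\<close>
  compares both sides with the same pair.\<close>

lemma (in cell_attachment) homology_attachment:
  "relative_homology_group k X A \<cong> relative_homology_group k (disk n) (cell_boundary n)"
proof -
  interpret D: cell_attachment n "disk n" "cell_boundary n" id by (rule cell_attachment_disk)
  have "relative_homology_group k (subtopology (disk n) (open_cell n)) {z \<in> open_cell n. disk_norm n z \<ge> 1/2}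
      \<cong> relative_homology_group k (disk n) (cell_boundary n)"
    by (rule group.iso_sym [OF group_relative_homology_group D.homology_open_cell])
  with homology_open_cell show ?thesis by (rule iso_trans)
qed

section \<open>Euler characteristics of cell complexes\<close>

text \<open>Take \<open>z\<close> representing the image of 1. Then \<open>h m\<close> is the class
  of \<open>m z\<close>, and surjectivity and injectivity of \<open>h\<close> become generation and
  freeness.\<close>

lemma rel_cell_if_infinite_cyclic:
  assumes iso: "relative_homology_group (int n) X A \<cong> integer_group"
    and triv: "\<And>k. k \<noteq> int n \<Longrightarrow> trivial_group (relative_homology_group k X A)"
  shows "\<exists>z. rel_cell n X A z"
proof -
  let ?H = "relative_homology_group (int n) X A" and ?c = "homologous_rel_set n X A"
  obtain h where h: "h \<in> iso integer_group ?H"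
    using group.iso_sym [OF group_relative_homology_group iso] by (auto simp: is_iso_def)
  have bij: "bij_betw h UNIV (carrier ?H)" using h by (simp add: iso_def)
  have hom: "h (i + j) = h i \<otimes>\<^bsub>?H\<^esub> h j" for i j
    using h by (simp add: iso_def hom_def)
  interpret H: group ?H by simp
  have h_closed: "h i \<in> carrier ?H" for i using bij by (auto simp: bij_betw_def)
  have mult: "?c a \<otimes>\<^bsub>?H\<^esub> ?c b = ?c (a + b)" if "singular_relcycle n X A a" "singular_relcycle n X A b" for a b
  proof -
    have "x \<in> (\<Union>r\<in>?c a. \<Union>s\<in>?c b. {r + s})" if "homologous_rel n X A (a + b) x" for x
    proof -
      have "x - b \<in> ?c a" using homologous_rel_diff [OF that homologous_rel_refl, of b] by simp
      moreover have "b \<in> ?c b" "x \<in> {(x - b) + b}" by simp_all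
      ultimately show ?thesis by blast
    qed
    then show ?thesis
      unfolding mult_relative_homology_group by (auto intro: homologous_rel_add)
  qed
  obtain z where z: "singular_relcycle n X A z" "h 1 = ?c z"
    using h_closed [of 1] unfolding carrier_relative_homology_group by auto
  have h0: "h 0 = ?c 0"
    using hom [of 0 0] h_closed [of 0] by (metis H.r_cancel_one' add_0 homologous_rel_eq_relboundary
        homologous_rel_set_eq_relboundary one_relative_homology_group singular_relboundary_0)
  have h_eq: "h m = ?c (frag_cmul m z)" for m
  proof (induction m rule: int_induct [where k = 0])
    case base
    then show ?case using h0 by simp
  next
    case (step1 i)
    then show ?case
      using hom [of i 1] z by (simp add: mult singular_relcycle_cmul frag_cmul_distrib)
  next
    \<comment> \<open>Going down, both candidates for \<open>h (i - 1)\<close> are multiplied by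
      \<open>h 1\<close>, which is then cancelled.\<close>
    case (step2 i)
    have "h (i - 1) \<otimes>\<^bsub>?H\<^esub> h 1 = ?c (frag_cmul (i - 1) z) \<otimes>\<^bsub>?H\<^esub> h 1"
      using hom [of "i - 1" 1] step2(2) z frag_cmul_distrib [of "i - 1" 1 z]
      by (simp add: mult singular_relcycle_cmul)
    moreover have "?c (frag_cmul (i - 1) z) \<in> carrier ?H"
      using singular_relcycle_cmul [OF z(1)] by (auto simp: carrier_relative_homology_group)
    ultimately show ?case using h_closed H.right_cancel by blast
  qed
  have "rel_cell n X A z"
    unfolding rel_cell_def
  proof (intro conjI allI impI)
    show "\<exists>m. singular_relboundary n X A (c - frag_cmul m z)" if "singular_relcycle n X A c" for c
    proof -
      have "?c c \<in> carrier ?H" using that by (auto simp: carrier_relative_homology_group)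
      then obtain m where "h m = ?c c" using bij by (metis UNIV_I bij_betw_def image_iff)
      then show ?thesis
        by (metis h_eq homologous_rel_def homologous_rel_set_eq)
    qed
    show "m = 0" if "singular_relboundary n X A (frag_cmul m z)" for m
    proof -
      have "h m = h 0"
        using that by (metis diff_zero h0 h_eq homologous_rel_def homologous_rel_set_eq)
      then show ?thesis using bij by (metis UNIV_I bij_betw_def inj_onD)
    qed
    show "singular_relboundary k X A c" if "k \<noteq> n" "singular_relcycle k X A c" for k c
    proof -
      have "homologous_rel_set k X A c \<in> carrier (relative_homology_group (int k) X A)"
        using that by (auto simp: carrier_relative_homology_group)
      then have "homologous_rel_set k X A c = singular_relboundary_set k X A"
        using triv [of "int k"] that by (simp add: trivial_group_def)
      then show ?thesis by (simp add: homologous_rel_set_eq_relboundary)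
    qed
  qed (rule z)
  then show ?thesis ..
qed

lemma (in cell_attachment) has_mod_euler_char_attachment:
  assumes "prime p" "has_mod_euler_char p (subtopology X A) e"
  shows "has_mod_euler_char p X (e + (-1) ^ n)"
proof -
  have "relative_homology_group (int n) X A \<cong> integer_group"
    using homology_attachment homology_disk_boundary(1) by (rule iso_trans)
  moreover have "trivial_group (relative_homology_group k X A)" if "k \<noteq> int n" for k
    using homology_disk_boundary(2) [OF that] isomorphic_group_triviality [OF homology_attachment]
    by simp
  ultimately obtain z where "rel_cell n X A z" using rel_cell_if_infinite_cyclic by blast
  then show ?thesis using assms by (rule has_mod_euler_char_rel_cell)
qed

lemma has_mod_euler_char_empty:
  assumes "topspace X = {}" shows "has_mod_euler_char p X 0"
proof -
  have "mod_homology_card p k X = 1" for k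
  proof -
    have "mod_cycle_set p k X = {0}"
      using assms add_subgroup_zero [OF add_subgroup_mod_cycle_set, of p k X]
      unfolding mod_cycle_set_def by (auto simp: singular_chain_empty)
    then show ?thesis by (simp add: mod_homology_card_def)
  qed
  then show ?thesis
    unfolding has_mod_euler_char_def by (intro exI [of _ "\<lambda>_. 0"]) simp
qed

text \<open>The cells are attached one at a time; compactness of the union reached so far makes it
  closed, as the next attachment requires. Injectivity on \<open>I \<times> open_cell n\<close> also
  says that different open cells are disjoint.\<close>

lemma has_mod_euler_char_cells:
  assumes T: "Hausdorff_space T" and p: "prime p" and "finite I"
    and A: "compactin T A" "has_mod_euler_char p (subtopology T A) e"
    and cont: "\<And>c. c \<in> I \<Longrightarrow> continuous_map (disk n) T (\<phi> c)"
    and boundary: "\<And>c. c \<in> I \<Longrightarrow> \<phi> c ` cell_boundary n \<subseteq> A"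
    and inj: "inj_on (\<lambda>(c, z). \<phi> c z) (I \<times> open_cell n)"
    and disjoint: "\<And>c. c \<in> I \<Longrightarrow> \<phi> c ` open_cell n \<inter> A = {}"
  shows "compactin T (A \<union> (\<Union>c\<in>I. \<phi> c ` topspace (disk n))) \<and>
    has_mod_euler_char p (subtopology T (A \<union> (\<Union>c\<in>I. \<phi> c ` topspace (disk n))))
      (e + int (card I) * (-1) ^ n)"
  using \<open>finite I\<close> cont boundary inj disjoint
proof (induction I rule: finite_induct)
  case empty
  then show ?case using A by simp
next
  case (insert c I)
  let ?A = "A \<union> (\<Union>c\<in>I. \<phi> c ` topspace (disk n))"
  have "inj_on (\<lambda>(c, z). \<phi> c z) (I \<times> open_cell n)"
    using insert.prems(3) by (rule inj_on_subset) auto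
  with insert have IH: "compactin T ?A" "has_mod_euler_char p (subtopology T ?A) (e + int (card I) * (-1) ^ n)"
    by auto
  let ?B = "?A \<union> \<phi> c ` topspace (disk n)"
  have cont: "continuous_map (disk n) T (\<phi> c)" using insert.prems by simp
  have B: "compactin T ?B"
    by (intro compactin_Un IH image_compactin [OF _ cont])
      (simp flip: compact_space_def add: compact_space_disk)
  \<comment> \<open>The previous stage includes closed cells: joint injectivity keeps the new open
    cell off their interiors, and their boundaries lie in \<open>A\<close>.\<close>
  have disjoint: "\<phi> c ` open_cell n \<inter> ?A = {}"
  proof -
    have "\<phi> c z \<noteq> \<phi> d w" if "z \<in> open_cell n" "d \<in> I" "w \<in> topspace (disk n)" for z d w
    proof (cases "w \<in> open_cell n")
      case True
      then show ?thesis using inj_onD [OF insert.prems(3), of "(c, z)" "(d, w)"] that insert.hyps by auto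
    next
      case False
      then have "\<phi> d w \<in> A" using insert.prems(2) [of d] that topspace_disk_eq [of n] by auto
      then show ?thesis using insert.prems(4) [of c] that by auto
    qed
    then show ?thesis using insert.prems(4) [of c] by auto
  qed
  interpret cell_attachment n "subtopology T ?B" ?A "\<phi> c"
  proof
    show "compact_space (subtopology T ?B)" using B by (rule compact_space_subtopology)
    show "Hausdorff_space (subtopology T ?B)" using T by (rule Hausdorff_space_subtopology)
    show "closedin (subtopology T ?B) ?A"
      using IH(1) T by (intro closedin_subset_topspace compactin_imp_closedin) auto
    show "continuous_map (disk n) (subtopology T ?B) (\<phi> c)"
      using cont by (auto simp: continuous_map_in_subtopology)
    show "\<phi> c ` cell_boundary n \<subseteq> ?A" using insert.prems(2) [of c] by auto
    show "inj_on (\<phi> c) (open_cell n)"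
      using insert.prems(3) by (force simp: inj_on_def)
    show "topspace (subtopology T ?B) = ?A \<union> \<phi> c ` topspace (disk n)"
      using compactin_subset_topspace [OF B] by auto
  qed (rule disjoint)
  have "subtopology (subtopology T ?B) ?A = subtopology T ?A"
    by (simp add: subtopology_subtopology Int_absorb1)
  then have "has_mod_euler_char p (subtopology T ?B) (e + int (card I) * (-1) ^ n + (-1) ^ n)"
    using has_mod_euler_char_attachment [OF p] IH(2) by simp
  moreover have "A \<union> (\<Union>c\<in>insert c I. \<phi> c ` topspace (disk n)) = ?B" by auto
  ultimately show ?case using B insert.hyps by (simp add: algebra_simps)
qed

section \<open>Homology groups modulo p and acyclic spaces\<close>

lemma card_mod_homology_group:
  "card (carrier (mod_homology_group p k X)) = mod_homology_card p k X"
proof -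
  let ?Z = "mod_cycle_set p k X" and ?B = "mod_boundary_set p k X"
  let ?K = "subgroup_generated (chain_group k X) ?Z"
  have "subgroup ?Z (chain_group k X)"
  proof
    show "?Z \<subseteq> carrier (chain_group k X)" by (auto simp: mod_cycle_set_def)
    show "x \<otimes>\<^bsub>chain_group k X\<^esub> y \<in> ?Z" if "x \<in> ?Z" "y \<in> ?Z" for x y
      using that by (simp add: add_subgroup_add add_subgroup_mod_cycle_set)
    show "\<one>\<^bsub>chain_group k X\<^esub> \<in> ?Z" by (simp add: add_subgroup_zero add_subgroup_mod_cycle_set)
    show "inv\<^bsub>chain_group k X\<^esub> x \<in> ?Z" if x: "x \<in> ?Z" for x
    proof -
      have "Poly_Mapping.keys x \<subseteq> singular_simplex_set k X"
        using x by (simp add: mod_cycle_set_def singular_chain_def)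
      then show ?thesis using x by (simp add: add_subgroup_minus add_subgroup_mod_cycle_set)
    qed
  qed
  then have "carrier ?K = ?Z"
    by (rule subgroup.carrier_subgroup_generated_subgroup)
  moreover have "?B #>\<^bsub>?K\<^esub> c = coset ?B c" for c
    by (force simp: r_coset_def coset_def subgroup_generated_def)
  ultimately have "carrier (mod_homology_group p k X) = coset ?B ` ?Z"
    by (auto simp: mod_homology_group_def FactGroup_def RCOSETS_def)
  then show ?thesis by (simp add: mod_homology_card_def)
qed

text \<open>Isomorphic groups have equal orders \<open>p ^ d k\<close>, and \<open>p > 1\<close>
  recovers the exponents.\<close>

lemma has_mod_euler_char_unique:
  assumes p: "prime p" and X: "has_mod_euler_char p X e" and Y: "has_mod_euler_char p Y e'"
    and iso: "\<And>k. mod_homology_group p k X \<cong> mod_homology_group p k Y"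
  shows "e = e'"
proof -
  obtain d where d: "\<And>k. mod_homology_card p k X = p ^ d k" "e = (\<Sum>k | d k \<noteq> 0. (-1) ^ k * int (d k))"
    using X unfolding has_mod_euler_char_def by blast
  obtain d' where d': "\<And>k. mod_homology_card p k Y = p ^ d' k" "e' = (\<Sum>k | d' k \<noteq> 0. (-1) ^ k * int (d' k))"
    using Y unfolding has_mod_euler_char_def by blast
  have "p ^ d k = p ^ d' k" for k
    using iso_same_card [OF iso [of k]] by (simp add: card_mod_homology_group d(1) d'(1))
  then have "d = d'" using prime_gt_1_nat [OF p] by auto
  then show ?thesis using d d' by simp
qed

text \<open>A point is one 0-cell attached to the empty set, so the cell count applies.\<close>

lemma has_mod_euler_char_point:
  assumes p: "prime p" shows "has_mod_euler_char p (discrete_topology {()}) 1"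
proof -
  let ?T = "discrete_topology {()}"
  have oc: "open_cell 0 = {\<lambda>i. 0}"
    by (auto simp: open_cell_def topspace_disk_0 disk_norm_def)
  have "has_mod_euler_char p (subtopology ?T ({} \<union> (\<Union>c\<in>{()}. (\<lambda>z. ()) ` topspace (disk 0))))
      (0 + int (card {()}) * (-1) ^ 0)"
    by (rule has_mod_euler_char_cells [THEN conjunct2, OF _ p])
      (auto simp: has_mod_euler_char_empty cell_boundary_0 oc)
  moreover have "{} \<union> (\<Union>c\<in>{()}. (\<lambda>z. ()) ` topspace (disk 0)) = {()}"
    by (simp add: topspace_disk_0)
  ultimately show ?thesis by (simp only:) simp
qed

lemma mod_acyclic_euler_char:
  "prime p \<Longrightarrow> mod_acyclic p X \<Longrightarrow> has_mod_euler_char p X e \<Longrightarrow> e = 1"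
  using has_mod_euler_char_unique has_mod_euler_char_point unfolding mod_acyclic_def by blast

section \<open>Fibres of finite \<open>\<G>\<close>-CW-complexes\<close>

context topological_groupoid
begin

lemma gcomp_closed:
  assumes "g \<in> topspace (Ar G)" "h \<in> topspace (Ar G)" "src G g = tgt G h"
  shows "gcomp G g h \<in> topspace (Ar G)"
proof -
  have "(g, h) \<in> topspace
      (kification (subtopology (prod_topology (Ar G) (Ar G)) {(g, h). src G g = tgt G h}))"
    using assms by simp
  then have "(case (g, h) of (g, h) \<Rightarrow> gcomp G g h) \<in> topspace (Ar G)"
    using continuous_map_image_subset_topspace [OF continuous_gcomp] by blast
  then show ?thesis by simp
qed

lemma ginv_closed: "g \<in> topspace (Ar G) \<Longrightarrow> ginv G g \<in> topspace (Ar G)"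
  using continuous_map_image_subset_topspace [OF continuous_ginv] by blast

lemma ident_closed: "x \<in> topspace (Ob G) \<Longrightarrow> ident G x \<in> topspace (Ar G)"
  using continuous_map_image_subset_topspace [OF continuous_ident] by blast

lemma src_closed: "g \<in> topspace (Ar G) \<Longrightarrow> src G g \<in> topspace (Ob G)"
  using continuous_map_image_subset_topspace [OF continuous_src] by blast

lemma carrier_isotropy_group:
  "carrier (isotropy_group G b) = {g \<in> topspace (Ar G). src G g = b \<and> tgt G g = b}"
  by (simp add: isotropy_group_def)

lemma mult_isotropy_group: "g \<otimes>\<^bsub>isotropy_group G b\<^esub> h = gcomp G g h"
  by (simp add: isotropy_group_def)

lemma arrow_exists:
  assumes "transitive_groupoid G" "x \<in> topspace (Ob G)" "y \<in> topspace (Ob G)"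
  obtains g where "g \<in> topspace (Ar G)" "src G g = x" "tgt G g = y"
proof -
  have "x \<in> orbit_of G x"
    using assms ident_closed [of x] src_ident tgt_ident by (force simp: orbit_of_def)
  also have "orbit_of G x = orbit_of G y"
    using assms unfolding transitive_groupoid_def is_singleton_def by blast
  finally show ?thesis using that by (auto simp: orbit_of_def)
qed

lemma gcomp_ginv_cancel:
  assumes "g \<in> topspace (Ar G)" "f \<in> topspace (Ar G)" "src G g = src G f"
  shows "gcomp G (gcomp G g (ginv G f)) f = g"
  using assms gcomp_assoc [of g "ginv G f" f] gcomp_ident [of g]
  by (simp add: ginv_closed src_ginv tgt_ginv ginv_gcomp)

lemma gcomp_cancel_ginv:
  assumes "g \<in> topspace (Ar G)" "f \<in> topspace (Ar G)" "src G g = tgt G f"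
  shows "gcomp G (gcomp G g f) (ginv G f) = g"
  using assms gcomp_assoc [of g f "ginv G f"] gcomp_ident [of g]
  by (simp add: ginv_closed tgt_ginv gcomp_ginv)

section \<open>Points of a coset space over an object\<close>

definition coset_fibre :: "'o \<Rightarrow> 'a set \<Rightarrow> 'o \<Rightarrow> 'a set set" where
  "coset_fibre b H y =
     {c \<in> topspace (Space (coset_gspace G b H)). anchor (coset_gspace G b H) c = y}"

lemma topspace_coset_gspace:
  "topspace (Space (coset_gspace G b H))
    = (\<lambda>f. (\<lambda>h. gcomp G h f) ` H) ` {f \<in> topspace (Ar G). tgt G f = b}"
proof -
  have "topspace (Ar G) \<inter> {f. tgt G f = b} = {f \<in> topspace (Ar G). tgt G f = b}" by auto
  then show ?thesis by (simp add: coset_gspace_def)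
qed

lemma anchor_coset:
  assumes "subgroup H (isotropy_group G b)" "f \<in> topspace (Ar G)" "tgt G f = b"
  shows "anchor (coset_gspace G b H) ((\<lambda>h. gcomp G h f) ` H) = src G f"
proof -
  have "src G (gcomp G h f) = src G f" if "h \<in> H" for h
    using assms subgroup.subset [OF assms(1)] that
    by (intro src_gcomp) (auto simp: carrier_isotropy_group)
  then have "src G ` (\<lambda>h. gcomp G h f) ` H = (\<lambda>h. src G f) ` H"
    unfolding image_image by (rule image_cong [OF refl])
  also have "\<dots> = {src G f}" using subgroup.one_closed [OF assms(1)] by blast
  finally show ?thesis by (simp add: coset_gspace_def)
qed

lemma coset_fibre_eq:
  assumes "subgroup H (isotropy_group G b)"
  shows "coset_fibre b H y
    = (\<lambda>f. (\<lambda>h. gcomp G h f) ` H) ` {f \<in> topspace (Ar G). tgt G f = b \<and> src G f = y}"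
  unfolding coset_fibre_def topspace_coset_gspace using anchor_coset [OF assms] by auto

text \<open>Precomposition with \<open>f\<close> carries the isotropy group bijectively onto the
  arrows from \<open>y\<close> to \<open>b\<close>. As \<open>H\<close> acts from the left, its
  orbits correspond to the right cosets \<open>H #> k\<close>, so the index of \<open>H\<close>
  counts the points over \<open>y\<close>.\<close>

lemma coset_fibre_rcosets:
  assumes K: "group (isotropy_group G b)" and H: "subgroup H (isotropy_group G b)"
    and f: "f \<in> topspace (Ar G)" "src G f = y" "tgt G f = b"
  shows "coset_fibre b H y = (\<lambda>C. (\<lambda>g. gcomp G g f) ` C) ` (rcosets\<^bsub>isotropy_group G b\<^esub> H)"
    (is "_ = _ ` (rcosets\<^bsub>?K\<^esub> H)")
    and "inj_on (\<lambda>C. (\<lambda>g. gcomp G g f) ` C) (rcosets\<^bsub>isotropy_group G b\<^esub> H)"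
proof -
  have sub: "H \<subseteq> carrier ?K" using H by (rule subgroup.subset)
  have translate: "(\<lambda>g. gcomp G g f) ` (H #>\<^bsub>?K\<^esub> k) = (\<lambda>h. gcomp G h (gcomp G k f)) ` H"
    if "k \<in> carrier ?K" for k
  proof -
    have "gcomp G (gcomp G h k) f = gcomp G h (gcomp G k f)" if "h \<in> H" for h
      using sub that \<open>k \<in> carrier ?K\<close> f by (intro gcomp_assoc) (auto simp: carrier_isotropy_group)
    then show ?thesis by (force simp: r_coset_def mult_isotropy_group)
  qed
  have arrows: "{g \<in> topspace (Ar G). tgt G g = b \<and> src G g = y} = (\<lambda>k. gcomp G k f) ` carrier ?K"
  proof
    show "(\<lambda>k. gcomp G k f) ` carrier ?K \<subseteq> {g \<in> topspace (Ar G). tgt G g = b \<and> src G g = y}"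
      using f by (auto simp: carrier_isotropy_group gcomp_closed tgt_gcomp src_gcomp)
    show "{g \<in> topspace (Ar G). tgt G g = b \<and> src G g = y} \<subseteq> (\<lambda>k. gcomp G k f) ` carrier ?K"
    proof
      fix g assume "g \<in> {g \<in> topspace (Ar G). tgt G g = b \<and> src G g = y}"
      then have g: "g \<in> topspace (Ar G)" "tgt G g = b" "src G g = y" by auto
      let ?k = "gcomp G g (ginv G f)"
      have "?k \<in> carrier ?K"
        using f g by (simp add: carrier_isotropy_group gcomp_closed ginv_closed src_ginv tgt_ginv src_gcomp tgt_gcomp)
      moreover have "gcomp G ?k f = g"
        using f g by (intro gcomp_ginv_cancel) auto
      ultimately show "g \<in> (\<lambda>k. gcomp G k f) ` carrier ?K" by (metis imageI)
    qed
  qed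
  have "coset_fibre b H y = (\<lambda>k. (\<lambda>h. gcomp G h (gcomp G k f)) ` H) ` carrier ?K"
    unfolding coset_fibre_eq [OF H] arrows by (simp add: image_image)
  also have "\<dots> = (\<lambda>k. (\<lambda>g. gcomp G g f) ` (H #>\<^bsub>?K\<^esub> k)) ` carrier ?K"
    by (rule image_cong) (simp_all add: translate)
  also have "\<dots> = (\<lambda>C. (\<lambda>g. gcomp G g f) ` C) ` (rcosets\<^bsub>?K\<^esub> H)"
    by (auto simp: RCOSETS_def)
  finally show "coset_fibre b H y = (\<lambda>C. (\<lambda>g. gcomp G g f) ` C) ` (rcosets\<^bsub>?K\<^esub> H)" .
  have inj: "inj_on (\<lambda>g. gcomp G g f) (carrier ?K)"
  proof (rule inj_onI)
    fix g h assume gh: "g \<in> carrier ?K" "h \<in> carrier ?K" and eq: "gcomp G g f = gcomp G h f"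
    have "g = gcomp G (gcomp G g f) (ginv G f)"
      using gh f by (intro gcomp_cancel_ginv [symmetric]) (auto simp: carrier_isotropy_group)
    also have "\<dots> = h"
      unfolding eq using gh f by (intro gcomp_cancel_ginv) (auto simp: carrier_isotropy_group)
    finally show "g = h" .
  qed
  have "C \<subseteq> carrier ?K" if "C \<in> rcosets\<^bsub>?K\<^esub> H" for C
    using group.rcosets_part_G [OF K H] that by blast
  then show "inj_on (\<lambda>C. (\<lambda>g. gcomp G g f) ` C) (rcosets\<^bsub>?K\<^esub> H)"
    using inj_on_image_eq_iff [OF inj] by (simp add: inj_on_def)
qed

text \<open>The index of \<open>H\<close> divides the order \<open>p ^ k\<close> of the group, so it
  is a power of p, and it is 1 only if \<open>H\<close> is everything.\<close>

lemma coset_fibre_card: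
  assumes K: "finite_p_group p (isotropy_group G b)" and p: "prime p"
    and H: "subgroup H (isotropy_group G b)"
    and f: "f \<in> topspace (Ar G)" "src G f = y" "tgt G f = b"
  shows "finite (coset_fibre b H y)"
    and "H \<noteq> carrier (isotropy_group G b) \<Longrightarrow> p dvd card (coset_fibre b H y)"
proof -
  let ?K = "isotropy_group G b"
  have gr: "group ?K" and fin: "finite (carrier ?K)" using K by (auto simp: finite_p_group_def)
  obtain k where k: "order ?K = p ^ k" using K by (auto simp: finite_p_group_def)
  note rc = coset_fibre_rcosets [OF gr H f]
  have "finite (\<Union>(rcosets\<^bsub>?K\<^esub> H))" using fin group.rcosets_part_G [OF gr H] by simp
  then show "finite (coset_fibre b H y)"
    unfolding rc(1) by (intro finite_imageI finite_UnionD)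
  have lag: "card (rcosets\<^bsub>?K\<^esub> H) * card H = p ^ k"
    using group.lagrange [OF gr H] k by simp
  assume "H \<noteq> carrier ?K"
  then have "H \<subset> carrier ?K" using subgroup.subset [OF H] by blast
  then have less: "card H < p ^ k" using psubset_card_mono [OF fin] k by (simp add: order_def)
  have "card (rcosets\<^bsub>?K\<^esub> H) dvd p ^ k" by (simp flip: lag)
  then obtain j where j: "card (rcosets\<^bsub>?K\<^esub> H) = p ^ j"
    using divides_primepow_nat [OF p] by blast
  have "j \<noteq> 0" using lag less j by (cases "j = 0") auto
  then show "p dvd card (coset_fibre b H y)"
    unfolding rc(1) by (simp add: card_image [OF rc(2)] j)
qed

end

text \<open>Continuity holds because the source map \<open>\<G>\<^sup>b \<rightarrow> \<G>\<^sup>0\<close> is a closed surjection: \<open>\<G>\<^sup>b\<close> is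
  compact.\<close>

lemma (in topological_groupoid) equivariant_section_of_fixed_point:
  assumes trans: "transitive_groupoid G" and proper: "compact_preimages (Ar G) (Ob G) (tgt G)"
    and b: "b \<in> topspace (Ob G)" and X: "right_G_space G X"
    and x: "x \<in> topspace (Space X)" "anchor X x = b"
    and fixed: "\<And>g. g \<in> carrier (isotropy_group G b) \<Longrightarrow> act X x g = x"
  shows "\<exists>\<sigma>. G_map G (object_gspace G) X \<sigma> \<and> (\<forall>y \<in> topspace (Ob G). anchor X (\<sigma> y) = y)"
proof -
  let ?Q = "subtopology (Ar G) {g. tgt G g = b}"
  have anchor_act: "anchor X (act X x g) = src G g"
    if "x \<in> topspace (Space X)" "g \<in> topspace (Ar G)" "anchor X x = tgt G g" for x g
    using X that by (simp add: right_G_space_def)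
  have act_act: "act X (act X x g) h = act X x (gcomp G g h)"
    if "x \<in> topspace (Space X)" "g \<in> topspace (Ar G)" "h \<in> topspace (Ar G)"
      "anchor X x = tgt G g" "src G g = tgt G h" for x g h
    using X that by (simp add: right_G_space_def)
  \<comment> \<open>The choice of arrow is immaterial: two arrows from \<open>y\<close> to
    \<open>b\<close> differ by an isotropy element at \<open>b\<close>, which fixes
    \<open>x\<close>.\<close>
  define \<sigma> where "\<sigma> y = act X x (SOME g. g \<in> topspace (Ar G) \<and> src G g = y \<and> tgt G g = b)" for y
  have \<sigma>: "\<sigma> (src G g) = act X x g" if g: "g \<in> topspace (Ar G)" "tgt G g = b" for g
  proof -
    define g' where "g' = (SOME g'. g' \<in> topspace (Ar G) \<and> src G g' = src G g \<and> tgt G g' = b)"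
    have g': "g' \<in> topspace (Ar G)" "src G g' = src G g" "tgt G g' = b"
      using someI [of "\<lambda>g'. g' \<in> topspace (Ar G) \<and> src G g' = src G g \<and> tgt G g' = b" g] g
      by (auto simp: g'_def)
    let ?k = "gcomp G g' (ginv G g)"
    have k: "?k \<in> carrier (isotropy_group G b)"
      using g g' by (simp add: carrier_isotropy_group gcomp_closed ginv_closed src_ginv tgt_ginv src_gcomp tgt_gcomp)
    have "gcomp G ?k g = g'"
      using g g' by (intro gcomp_ginv_cancel) auto
    then have "act X x g' = act X (act X x ?k) g"
      using act_act [of x ?k g] k x g by (simp add: carrier_isotropy_group)
    then show ?thesis using fixed [OF k] by (simp add: \<sigma>_def g'_def)
  qed
  have Q: "compact_space ?Q"
  proof -
    have "compactin (Ob G) {b}" using b by simp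
    then have "compactin (Ar G) {g \<in> topspace (Ar G). tgt G g \<in> {b}}"
      using proper unfolding compact_preimages_def by blast
    also have "{g \<in> topspace (Ar G). tgt G g \<in> {b}} = topspace (Ar G) \<inter> {g. tgt G g = b}" by auto
    finally have "compact_space (subtopology (Ar G) (topspace (Ar G) \<inter> {g. tgt G g = b}))"
      by (rule compact_space_subtopology)
    then show ?thesis by (simp only: subtopology_restrict)
  qed
  have quot: "quotient_map ?Q (Ob G) (src G)"
  proof (rule continuous_imp_quotient_map [OF _ Q Ob_space(1)])
    show "continuous_map ?Q (Ob G) (src G)"
      by (rule continuous_map_from_subtopology [OF continuous_src])
    show "src G ` topspace ?Q = topspace (Ob G)"
    proof
      show "src G ` topspace ?Q \<subseteq> topspace (Ob G)" using src_closed by auto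
      show "topspace (Ob G) \<subseteq> src G ` topspace ?Q"
      proof
        fix y assume "y \<in> topspace (Ob G)"
        then obtain g where "g \<in> topspace (Ar G)" "src G g = y" "tgt G g = b"
          using arrow_exists [OF trans _ b] by blast
        then show "y \<in> src G ` topspace ?Q" by force
      qed
    qed
  qed
  \<comment> \<open>The action is continuous for the k-ified topology. A map into the k-ification is
    continuous once it is so for the original topology, because \<open>?Q\<close> is compact and
    thus a k-space.\<close>
  have "continuous_map ?Q (subtopology (prod_topology (Space X) (Ar G)) {(x, g). anchor X x = tgt G g})
      (\<lambda>g. (x, g))"
    using x by (auto simp: continuous_map_in_subtopology continuous_map_pairwise o_def
        continuous_map_from_subtopology)
  then have "continuous_map ?Q
      (kification (subtopology (prod_topology (Space X) (Ar G)) {(x, g). anchor X x = tgt G g}))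
      (\<lambda>g. (x, g))"
    by (simp add: continuous_map_into_kification compact_imp_k_space Q)
  then have "continuous_map ?Q (Space X) ((\<lambda>(x, g). act X x g) \<circ> (\<lambda>g. (x, g)))"
    using X unfolding right_G_space_def by (blast intro: continuous_map_compose)
  then have "continuous_map ?Q (Space X) (\<sigma> \<circ> src G)"
    by (rule continuous_map_eq) (auto simp: \<sigma>)
  then have cont: "continuous_map (Ob G) (Space X) \<sigma>"
    by (rule continuous_compose_quotient_map [OF quot])
  have anchor_\<sigma>: "anchor X (\<sigma> y) = y" if y: "y \<in> topspace (Ob G)" for y
  proof -
    obtain g where "g \<in> topspace (Ar G)" "src G g = y" "tgt G g = b"
      using arrow_exists [OF trans y b] by blast
    then show ?thesis using \<sigma> [of g] anchor_act [of x g] x by simp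
  qed
  have "\<sigma> (src G g) = act X (\<sigma> (tgt G g)) g"
    if g: "g \<in> topspace (Ar G)" "tgt G g \<in> topspace (Ob G)" for g
  proof -
    \<comment> \<open>Continuing \<open>g\<close> by an arrow \<open>f\<close> to \<open>b\<close>
      gives an arrow defining \<sigma> at \<open>src G g\<close>, and
      \<open>x (f g) = (x f) g\<close> is equivariance.\<close>
    obtain f where f: "f \<in> topspace (Ar G)" "src G f = tgt G g" "tgt G f = b"
      using arrow_exists [OF trans g(2) b] by blast
    have "\<sigma> (src G (gcomp G f g)) = act X x (gcomp G f g)"
      using f g by (intro \<sigma>) (simp_all add: gcomp_closed tgt_gcomp)
    moreover have "\<sigma> (tgt G g) = act X x f" using \<sigma> [of f] f by simp
    ultimately show ?thesis using act_act [of x f g] f g x by (simp add: src_gcomp)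
  qed
  then have "G_map G (object_gspace G) X \<sigma>"
    unfolding G_map_def object_gspace_def using cont anchor_\<sigma> by auto
  then show ?thesis using anchor_\<sigma> by blast
qed

text \<open>For an inclusion of \<open>A\<close> into \<open>C\<close>, the generated relation only
  glues each \<open>a\<close> in \<open>A\<close> to \<open>f a\<close>; points of \<open>C\<close>
  outside \<open>A\<close> are alone in their classes, hence new and distinct in the
  pushout.\<close>

lemma pushout_square_inclusion:
  assumes po: "pushout_square A B C D f id id k"
  shows "topspace D = topspace B \<union> k ` topspace C"
    and "a \<in> topspace A \<Longrightarrow> k a = f a \<and> f a \<in> topspace B"
    and "c \<in> topspace C - topspace A \<Longrightarrow> k c \<notin> topspace B"
    and "inj_on k (topspace C - topspace A)"
proof -
  let ?r = "\<lambda>u v. \<exists>a \<in> topspace A. u = Inl (f a) \<and> v = Inr (id a)"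
  let ?U = "Inl ` topspace B \<union> Inr ` topspace C"
  have f: "continuous_map A B f" and i: "continuous_map A C id"
    and top: "topspace D = topspace B \<union> k ` topspace C"
    and ker: "\<And>u v. u \<in> ?U \<Longrightarrow> v \<in> ?U \<Longrightarrow> case_sum id k u = case_sum id k v \<longleftrightarrow> equivclp ?r u v"
    using po unfolding pushout_square_def by auto
  show "topspace D = topspace B \<union> k ` topspace C" by (rule top)
  show "k a = f a \<and> f a \<in> topspace B" if a: "a \<in> topspace A"
  proof
    show fa: "f a \<in> topspace B"
      using continuous_map_image_subset_topspace [OF f] a by blast
    have "a \<in> topspace C"
      using continuous_map_image_subset_topspace [OF i] a by auto
    moreover have "equivclp ?r (Inl (f a)) (Inr a)"
      using a by (intro r_into_equivclp) auto
    ultimately show "k a = f a" using ker [of "Inl (f a)" "Inr a"] fa by simp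
  qed
  \<comment> \<open>No generating pair involves \<open>Inr c\<close>, so no chain of identifications
    can leave it.\<close>
  have rigid: "v = Inr c" if "equivclp ?r (Inr c) v" "c \<notin> topspace A" for c v
    using that by (induction rule: equivclp_induct) auto
  show "k c \<notin> topspace B" if c: "c \<in> topspace C - topspace A"
    using ker [of "Inr c" "Inl (k c)"] rigid [of c "Inl (k c)"] c by auto
  show "inj_on k (topspace C - topspace A)"
  proof (rule inj_onI)
    fix c d assume "c \<in> topspace C - topspace A" "d \<in> topspace C - topspace A" "k c = k d"
    then show "c = d" using ker [of "Inr c" "Inr d"] rigid [of c "Inr d"] by auto
  qed
qed

text \<open>Fixing a coset turns an equivariant cell into an ordinary disk in the space. Compactness
  of the disk again deals with the k-ified product.\<close>

lemma continuous_map_sum_cell: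
  assumes "continuous_map (sum_topology (\<lambda>i. kification (prod_topology (Y i) (disk n))) J) T \<Phi>"
    and "i \<in> J" "c \<in> topspace (Y i)"
  shows "continuous_map (disk n) T (\<lambda>z. \<Phi> (i, (c, z)))"
proof -
  have "continuous_map (disk n) (prod_topology (Y i) (disk n)) (\<lambda>z. (c, z))"
    using assms(3) by (simp add: continuous_map_pairwise o_def)
  then have "continuous_map (disk n) (kification (prod_topology (Y i) (disk n))) (\<lambda>z. (c, z))"
    by (simp add: continuous_map_into_kification compact_imp_k_space compact_space_disk)
  then have "continuous_map (disk n)
      (sum_topology (\<lambda>i. kification (prod_topology (Y i) (disk n))) J) ((\<lambda>w. (i, w)) \<circ> (\<lambda>z. (c, z)))"
    using continuous_map_component_injection [OF assms(2)] by (rule continuous_map_compose)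
  from continuous_map_compose [OF this assms(1)] show ?thesis by (simp add: o_def)
qed

section \<open>Cells of a G-CW-complex and of its fibres\<close>

locale G_CW = topological_groupoid G for G :: "('o, 'a) groupoid" +
  fixes b :: 'o and X :: "('x, 'o, 'a) gspace" and sk :: "nat \<Rightarrow> 'x set" and N :: "nat \<Rightarrow> nat"
    and H :: "nat \<Rightarrow> nat \<Rightarrow> 'a set"
  assumes G_CW: "G_CW_structure G b X sk N H"
begin

lemma space: "right_G_space G X" and colimit: "colimit_of (Space X) sk"
  and subgroup_H: "i < N n \<Longrightarrow> subgroup (H n i) (isotropy_group G b)"
  using G_CW unfolding G_CW_structure_def by blast+

lemma Hausdorff_X: "Hausdorff_space (Space X)"
  using space by (simp add: right_G_space_def)

lemma skeleton_subset: "sk n \<subseteq> topspace (Space X)"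
  using colimit by (auto simp: colimit_of_def)

lemma topspace_skeleton: "topspace (subtopology (Space X) (sk n)) = sk n"
  using skeleton_subset by (simp add: Int_absorb1)

text \<open>Indexes the \<open>n\<close>-cells of the fibre over \<open>y\<close>: an equivariant
  cell meets that fibre in one disk for each coset over \<open>y\<close>.\<close>

definition fibre_cells :: "nat \<Rightarrow> 'o \<Rightarrow> (nat \<times> 'a set) set" where
  "fibre_cells n y = Sigma {..<N n} (\<lambda>i. coset_fibre b (H n i) y)"

lemma card_fibre_cells:
  assumes "finite_p_group p (isotropy_group G b)" "prime p"
    and "g \<in> topspace (Ar G)" "src G g = y" "tgt G g = b"
  shows "finite (fibre_cells n y)"
    and "(\<And>i. i < N n \<Longrightarrow> H n i \<noteq> carrier (isotropy_group G b)) \<Longrightarrow> p dvd card (fibre_cells n y)"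
proof -
  note coset = coset_fibre_card [OF assms(1,2) subgroup_H assms(3-5)]
  show "finite (fibre_cells n y)" unfolding fibre_cells_def using coset(1) by blast
  show "p dvd card (fibre_cells n y)"
    if "\<And>i. i < N n \<Longrightarrow> H n i \<noteq> carrier (isotropy_group G b)"
    unfolding fibre_cells_def using coset that by (subst card_SigmaI) (auto intro!: dvd_sum)
qed

lemma zero_cells:
  obtains \<theta> where
    "\<And>i c. i < N 0 \<Longrightarrow> c \<in> topspace (Space (coset_gspace G b (H 0 i))) \<Longrightarrow>
       anchor X (\<theta> (i, c)) = anchor (coset_gspace G b (H 0 i)) c"
    "\<And>i c g. i < N 0 \<Longrightarrow> c \<in> topspace (Space (coset_gspace G b (H 0 i))) \<Longrightarrow> g \<in> topspace (Ar G)
       \<Longrightarrow> anchor (coset_gspace G b (H 0 i)) c = tgt G g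
       \<Longrightarrow> \<theta> (i, act (coset_gspace G b (H 0 i)) c g) = act X (\<theta> (i, c)) g"
    "inj_on \<theta> (Sigma {..<N 0} (\<lambda>i. topspace (Space (coset_gspace G b (H 0 i)))))"
    "sk 0 = \<theta> ` Sigma {..<N 0} (\<lambda>i. topspace (Space (coset_gspace G b (H 0 i))))"
proof -
  let ?S = "sum_gspace {..<N 0} (\<lambda>i. coset_gspace G b (H 0 i))"
  obtain \<theta> where G_map: "G_map G ?S (sub_gspace X (sk 0)) \<theta>"
    and homeo: "homeomorphic_map (Space ?S) (subtopology (Space X) (sk 0)) \<theta>"
    using G_CW unfolding G_CW_structure_def by blast
  have top: "topspace (Space ?S) = Sigma {..<N 0} (\<lambda>i. topspace (Space (coset_gspace G b (H 0 i))))"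
    by (simp add: sum_gspace_def o_def)
  show thesis
  proof
    show "anchor X (\<theta> (i, c)) = anchor (coset_gspace G b (H 0 i)) c"
      if "i < N 0" "c \<in> topspace (Space (coset_gspace G b (H 0 i)))" for i c
    proof -
      have "(i, c) \<in> topspace (Space ?S)" using that top by simp
      then have "anchor (sub_gspace X (sk 0)) (\<theta> (i, c)) = anchor ?S (i, c)"
        using G_map unfolding G_map_def by blast
      then show ?thesis by (simp add: sub_gspace_def sum_gspace_def)
    qed
    show "\<theta> (i, act (coset_gspace G b (H 0 i)) c g) = act X (\<theta> (i, c)) g"
      if "i < N 0" "c \<in> topspace (Space (coset_gspace G b (H 0 i)))" "g \<in> topspace (Ar G)"
        "anchor (coset_gspace G b (H 0 i)) c = tgt G g" for i c g
    proof -
      have "(i, c) \<in> topspace (Space ?S)" using that top by simp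
      moreover have "anchor ?S (i, c) = tgt G g" using that by (simp add: sum_gspace_def)
      ultimately have "\<theta> (act ?S (i, c) g) = act (sub_gspace X (sk 0)) (\<theta> (i, c)) g"
        using G_map that(3) unfolding G_map_def by blast
      then show ?thesis by (simp add: sub_gspace_def sum_gspace_def)
    qed
    show "inj_on \<theta> (Sigma {..<N 0} (\<lambda>i. topspace (Space (coset_gspace G b (H 0 i)))))"
      using homeomorphic_imp_injective_map [OF homeo] by (simp only: top)
    show "sk 0 = \<theta> ` Sigma {..<N 0} (\<lambda>i. topspace (Space (coset_gspace G b (H 0 i))))"
      using homeomorphic_imp_surjective_map [OF homeo] by (simp only: top topspace_skeleton)
  qed
qed

text \<open>The pushout of G-spaces, read on single disks: \<open>nsphere n\<close> is the boundary
  of \<open>disk (Suc n)\<close>, so boundary points are glued into \<open>sk n\<close> and interior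
  points are new.\<close>

lemma higher_cells:
  obtains \<Phi> where
    "\<And>i c. i < N (Suc n) \<Longrightarrow> c \<in> topspace (Space (coset_gspace G b (H (Suc n) i))) \<Longrightarrow>
       continuous_map (disk (Suc n)) (Space X) (\<lambda>z. \<Phi> (i, (c, z)))"
    "\<And>i c z. i < N (Suc n) \<Longrightarrow> c \<in> topspace (Space (coset_gspace G b (H (Suc n) i))) \<Longrightarrow>
       z \<in> topspace (disk (Suc n)) \<Longrightarrow>
       anchor X (\<Phi> (i, (c, z))) = anchor (coset_gspace G b (H (Suc n) i)) c"
    "\<And>i c z g. i < N (Suc n) \<Longrightarrow> c \<in> topspace (Space (coset_gspace G b (H (Suc n) i))) \<Longrightarrow>
       z \<in> topspace (disk (Suc n)) \<Longrightarrow> g \<in> topspace (Ar G) \<Longrightarrow>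
       anchor (coset_gspace G b (H (Suc n) i)) c = tgt G g \<Longrightarrow>
       \<Phi> (i, (act (coset_gspace G b (H (Suc n) i)) c g, z)) = act X (\<Phi> (i, (c, z))) g"
    "\<And>i c z. i < N (Suc n) \<Longrightarrow> c \<in> topspace (Space (coset_gspace G b (H (Suc n) i))) \<Longrightarrow>
       z \<in> cell_boundary (Suc n) \<Longrightarrow> \<Phi> (i, (c, z)) \<in> sk n"
    "\<And>i c z. i < N (Suc n) \<Longrightarrow> c \<in> topspace (Space (coset_gspace G b (H (Suc n) i))) \<Longrightarrow>
       z \<in> open_cell (Suc n) \<Longrightarrow> \<Phi> (i, (c, z)) \<notin> sk n"
    "inj_on \<Phi> (Sigma {..<N (Suc n)}
       (\<lambda>i. topspace (Space (coset_gspace G b (H (Suc n) i))) \<times> open_cell (Suc n)))"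
    "sk (Suc n) = sk n \<union> \<Phi> ` Sigma {..<N (Suc n)}
       (\<lambda>i. topspace (Space (coset_gspace G b (H (Suc n) i))) \<times> topspace (disk (Suc n)))"
proof -
  let ?C = "\<lambda>i. coset_gspace G b (H (Suc n) i)"
  let ?S = "sum_gspace {..<N (Suc n)} (\<lambda>i. prod_gspace (?C i) (nsphere n))"
  let ?D = "sum_gspace {..<N (Suc n)} (\<lambda>i. prod_gspace (?C i) (disk (Suc n)))"
  obtain \<phi> \<Phi> where G_map: "G_map G ?D (sub_gspace X (sk (Suc n))) \<Phi>"
    and po: "pushout_square (Space ?S) (subtopology (Space X) (sk n))
      (Space ?D) (subtopology (Space X) (sk (Suc n))) \<phi> id id \<Phi>"
    using G_CW unfolding G_CW_structure_def Let_def by blast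
  note push = pushout_square_inclusion [OF po, unfolded topspace_skeleton]
  have topD: "topspace (Space ?D) = Sigma {..<N (Suc n)} (\<lambda>i. topspace (Space (?C i)) \<times> topspace (disk (Suc n)))"
    and topS: "topspace (Space ?S) = Sigma {..<N (Suc n)} (\<lambda>i. topspace (Space (?C i)) \<times> cell_boundary (Suc n))"
    by (simp_all add: sum_gspace_def prod_gspace_def cell_boundary_Suc o_def)
  have "open_cell (Suc n) = topspace (disk (Suc n)) - cell_boundary (Suc n)"
    by (auto simp: open_cell_def cell_boundary_def topspace_disk)
  then have topE: "topspace (Space ?D) - topspace (Space ?S)
      = Sigma {..<N (Suc n)} (\<lambda>i. topspace (Space (?C i)) \<times> open_cell (Suc n))"
    unfolding topD topS by blast
  have "continuous_map (Space ?D) (Space X) \<Phi>"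
    using G_map unfolding G_map_def sub_gspace_def by (simp add: continuous_map_in_subtopology)
  then have cont: "continuous_map
      (sum_topology (\<lambda>i. kification (prod_topology (Space (?C i)) (disk (Suc n)))) {..<N (Suc n)}) (Space X) \<Phi>"
    by (simp add: sum_gspace_def prod_gspace_def)
  show thesis
  proof
    show "continuous_map (disk (Suc n)) (Space X) (\<lambda>z. \<Phi> (i, (c, z)))"
      if "i < N (Suc n)" "c \<in> topspace (Space (?C i))" for i c
      using that by (intro continuous_map_sum_cell [OF cont]) auto
    show "anchor X (\<Phi> (i, (c, z))) = anchor (?C i) c"
      if "i < N (Suc n)" "c \<in> topspace (Space (?C i))" "z \<in> topspace (disk (Suc n))" for i c z
    proof -
      have "(i, (c, z)) \<in> topspace (Space ?D)" using that topD by simp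
      then have "anchor (sub_gspace X (sk (Suc n))) (\<Phi> (i, (c, z))) = anchor ?D (i, (c, z))"
        using G_map unfolding G_map_def by blast
      then show ?thesis by (simp add: sub_gspace_def sum_gspace_def prod_gspace_def)
    qed
    show "\<Phi> (i, (act (?C i) c g, z)) = act X (\<Phi> (i, (c, z))) g"
      if "i < N (Suc n)" "c \<in> topspace (Space (?C i))" "z \<in> topspace (disk (Suc n))"
        "g \<in> topspace (Ar G)" "anchor (?C i) c = tgt G g" for i c z g
    proof -
      have "(i, (c, z)) \<in> topspace (Space ?D)" using that topD by simp
      moreover have "anchor ?D (i, (c, z)) = tgt G g"
        using that by (simp add: sum_gspace_def prod_gspace_def)
      ultimately have "\<Phi> (act ?D (i, (c, z)) g) = act (sub_gspace X (sk (Suc n))) (\<Phi> (i, (c, z))) g"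
        using G_map that(4) unfolding G_map_def by blast
      then show ?thesis by (simp add: sub_gspace_def sum_gspace_def prod_gspace_def)
    qed
    show "\<Phi> (i, (c, z)) \<in> sk n"
      if "i < N (Suc n)" "c \<in> topspace (Space (?C i))" "z \<in> cell_boundary (Suc n)" for i c z
      using push(2) [of "(i, (c, z))"] that topS by simp
    show "\<Phi> (i, (c, z)) \<notin> sk n"
      if "i < N (Suc n)" "c \<in> topspace (Space (?C i))" "z \<in> open_cell (Suc n)" for i c z
      using push(3) [unfolded topE, of "(i, (c, z))"] that by simp
    show "inj_on \<Phi> (Sigma {..<N (Suc n)} (\<lambda>i. topspace (Space (?C i)) \<times> open_cell (Suc n)))"
      using push(4) unfolding topE .
    show "sk (Suc n) = sk n \<union> \<Phi> ` Sigma {..<N (Suc n)}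
       (\<lambda>i. topspace (Space (?C i)) \<times> topspace (disk (Suc n)))"
      using push(1) unfolding topD .
  qed
qed

text \<open>The anchor ignores the disk coordinate, so each step attaches to the fibre one whole
  disk for every element of \<open>fibre_cells\<close>. Compactness is what
  \<open>has_mod_euler_char_cells\<close> asks of the preceding stage.\<close>

lemma skeleton_fibre_euler_char:
  assumes K: "finite_p_group p (isotropy_group G b)" and p: "prime p"
    and g: "g \<in> topspace (Ar G)" "src G g = y" "tgt G g = b"
    and proper: "\<And>m i. i < N m \<Longrightarrow> H m i \<noteq> carrier (isotropy_group G b)"
  shows "compactin (Space X) {x \<in> sk n. anchor X x = y} \<and>
    (\<exists>e. has_mod_euler_char p (subtopology (Space X) {x \<in> sk n. anchor X x = y}) e \<and> int p dvd e)"
proof (induction n)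
  case 0
  obtain \<theta> where anchor: "\<And>i c. i < N 0 \<Longrightarrow> c \<in> topspace (Space (coset_gspace G b (H 0 i))) \<Longrightarrow>
       anchor X (\<theta> (i, c)) = anchor (coset_gspace G b (H 0 i)) c"
    and inj: "inj_on \<theta> (Sigma {..<N 0} (\<lambda>i. topspace (Space (coset_gspace G b (H 0 i)))))"
    and sk: "sk 0 = \<theta> ` Sigma {..<N 0} (\<lambda>i. topspace (Space (coset_gspace G b (H 0 i))))"
    by (rule zero_cells) (rule that; assumption)
  let ?I = "fibre_cells 0 y"
  have "{x \<in> sk 0. anchor X x = y} = \<theta> ` ?I"
  proof (intro equalityI subsetI)
    fix x assume "x \<in> {x \<in> sk 0. anchor X x = y}"
    then obtain i c where "i < N 0" "c \<in> topspace (Space (coset_gspace G b (H 0 i)))" "x = \<theta> (i, c)"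
      "anchor X x = y"
      unfolding sk by auto
    then have "(i, c) \<in> ?I" "x = \<theta> (i, c)" using anchor by (auto simp: fibre_cells_def coset_fibre_def)
    then show "x \<in> \<theta> ` ?I" by blast
  next
    fix x assume "x \<in> \<theta> ` ?I"
    then obtain i c where ic: "i < N 0" "c \<in> topspace (Space (coset_gspace G b (H 0 i)))" "x = \<theta> (i, c)"
      "anchor (coset_gspace G b (H 0 i)) c = y"
      by (auto simp: fibre_cells_def coset_fibre_def)
    then have "x \<in> sk 0" unfolding sk by auto
    then show "x \<in> {x \<in> sk 0. anchor X x = y}" using ic anchor by simp
  qed
  \<comment> \<open>The finite fibre of the 0-skeleton is presented as 0-cells attached to the empty
    set, so that both stages use the same cell count.\<close>
  then have eq: "{x \<in> sk 0. anchor X x = y} = {} \<union> (\<Union>c\<in>?I. (\<lambda>z. \<theta> c) ` topspace (disk 0))"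
    unfolding topspace_disk_0 by auto
  have open0: "open_cell 0 = {\<lambda>i. 0}"
    by (auto simp: open_cell_def topspace_disk_0 disk_norm_def)
  have I: "?I \<subseteq> Sigma {..<N 0} (\<lambda>i. topspace (Space (coset_gspace G b (H 0 i))))"
    by (auto simp: fibre_cells_def coset_fibre_def)
  have "compactin (Space X) {x \<in> sk 0. anchor X x = y} \<and>
    has_mod_euler_char p (subtopology (Space X) {x \<in> sk 0. anchor X x = y}) (0 + int (card ?I) * (-1) ^ 0)"
    unfolding eq
  proof (rule has_mod_euler_char_cells [OF Hausdorff_X p, where \<phi> = "\<lambda>w z. \<theta> w"])
    show "finite ?I" by (rule card_fibre_cells [OF K p g])
    show "has_mod_euler_char p (subtopology (Space X) {}) 0"
      by (rule has_mod_euler_char_empty) simp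
    show "continuous_map (disk 0) (Space X) (\<lambda>z. \<theta> c)" if "c \<in> ?I" for c
      using that I skeleton_subset [of 0] unfolding sk by auto
    show "inj_on (\<lambda>(c, z). \<theta> c) (?I \<times> open_cell 0)"
      using inj_on_subset [OF inj I] by (auto simp: open0 inj_on_def)
  qed (auto simp: cell_boundary_0)
  moreover have "p dvd card ?I" using proper by (intro card_fibre_cells [OF K p g]) auto
  ultimately show ?case by auto
next
  case (Suc n)
  let ?C = "\<lambda>i. coset_gspace G b (H (Suc n) i)"
  obtain \<Phi> where
    cont: "\<And>i c. i < N (Suc n) \<Longrightarrow> c \<in> topspace (Space (?C i)) \<Longrightarrow>
       continuous_map (disk (Suc n)) (Space X) (\<lambda>z. \<Phi> (i, (c, z)))"
    and anchor: "\<And>i c z. i < N (Suc n) \<Longrightarrow> c \<in> topspace (Space (?C i)) \<Longrightarrow>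
       z \<in> topspace (disk (Suc n)) \<Longrightarrow> anchor X (\<Phi> (i, (c, z))) = anchor (?C i) c"
    and boundary: "\<And>i c z. i < N (Suc n) \<Longrightarrow> c \<in> topspace (Space (?C i)) \<Longrightarrow>
       z \<in> cell_boundary (Suc n) \<Longrightarrow> \<Phi> (i, (c, z)) \<in> sk n"
    and disjoint: "\<And>i c z. i < N (Suc n) \<Longrightarrow> c \<in> topspace (Space (?C i)) \<Longrightarrow>
       z \<in> open_cell (Suc n) \<Longrightarrow> \<Phi> (i, (c, z)) \<notin> sk n"
    and inj: "inj_on \<Phi> (Sigma {..<N (Suc n)} (\<lambda>i. topspace (Space (?C i)) \<times> open_cell (Suc n)))"
    and sk: "sk (Suc n) = sk n \<union> \<Phi> ` Sigma {..<N (Suc n)}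
       (\<lambda>i. topspace (Space (?C i)) \<times> topspace (disk (Suc n)))"
    by (rule higher_cells [of n]) (rule that; assumption)
  let ?I = "fibre_cells (Suc n) y" and ?\<phi> = "\<lambda>(i, c) z. \<Phi> (i, (c, z))"
  let ?A = "{x \<in> sk n. anchor X x = y}"
  obtain e where A: "compactin (Space X) ?A" and e: "has_mod_euler_char p (subtopology (Space X) ?A) e" "int p dvd e"
    using Suc.IH by blast
  have I: "i < N (Suc n)" "c \<in> topspace (Space (?C i))" "anchor (?C i) c = y" if "(i, c) \<in> ?I" for i c
    using that by (auto simp: fibre_cells_def coset_fibre_def)
  have eq: "{x \<in> sk (Suc n). anchor X x = y} = ?A \<union> (\<Union>c\<in>?I. ?\<phi> c ` topspace (disk (Suc n)))"
  proof (intro equalityI subsetI)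
    fix x assume x: "x \<in> {x \<in> sk (Suc n). anchor X x = y}"
    show "x \<in> ?A \<union> (\<Union>c\<in>?I. ?\<phi> c ` topspace (disk (Suc n)))"
    proof (cases "x \<in> sk n")
      case False
      then obtain i c z where z: "i < N (Suc n)" "c \<in> topspace (Space (?C i))"
        "z \<in> topspace (disk (Suc n))" "x = \<Phi> (i, (c, z))"
        using x unfolding sk by auto
      then have "(i, c) \<in> ?I" using x anchor by (auto simp: fibre_cells_def coset_fibre_def)
      moreover have "x \<in> ?\<phi> (i, c) ` topspace (disk (Suc n))" using z by auto
      ultimately show ?thesis by blast
    qed (use x in blast)
  next
    fix x assume "x \<in> ?A \<union> (\<Union>c\<in>?I. ?\<phi> c ` topspace (disk (Suc n)))"
    then show "x \<in> {x \<in> sk (Suc n). anchor X x = y}"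
    proof
      assume "x \<in> (\<Union>c\<in>?I. ?\<phi> c ` topspace (disk (Suc n)))"
      then obtain i c z where z: "(i, c) \<in> ?I" "z \<in> topspace (disk (Suc n))" "x = \<Phi> (i, (c, z))" by auto
      then show ?thesis using I [OF z(1)] anchor [of i c z] unfolding sk by auto
    qed (auto simp: sk)
  qed
  have "compactin (Space X) {x \<in> sk (Suc n). anchor X x = y} \<and>
    has_mod_euler_char p (subtopology (Space X) {x \<in> sk (Suc n). anchor X x = y})
      (e + int (card ?I) * (-1) ^ Suc n)"
    unfolding eq
  proof (rule has_mod_euler_char_cells [OF Hausdorff_X p _ A e(1), where \<phi> = ?\<phi>])
    show "finite ?I" by (rule card_fibre_cells [OF K p g])
    show "continuous_map (disk (Suc n)) (Space X) (?\<phi> w)" if "w \<in> ?I" for w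
      using that I cont by (cases w) simp
    show "?\<phi> w ` cell_boundary (Suc n) \<subseteq> ?A" if "w \<in> ?I" for w
    proof (cases w)
      case (Pair i c)
      then show ?thesis
        using I [of i c] that boundary [of i c] anchor [of i c] topspace_disk_eq [of "Suc n"] by auto
    qed
    show "?\<phi> w ` open_cell (Suc n) \<inter> ?A = {}" if "w \<in> ?I" for w
    proof (cases w)
      case (Pair i c)
      then show ?thesis using I [of i c] that disjoint [of i c] by auto
    qed
    show "inj_on (\<lambda>(w, z). ?\<phi> w z) (?I \<times> open_cell (Suc n))"
    proof (rule inj_onI)
      fix u v
      assume uv: "u \<in> ?I \<times> open_cell (Suc n)" "v \<in> ?I \<times> open_cell (Suc n)"
        and eq: "(\<lambda>(w, z). ?\<phi> w z) u = (\<lambda>(w, z). ?\<phi> w z) v"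
      obtain i c z i' c' z' where u: "u = ((i, c), z)" and v: "v = ((i', c'), z')" by (metis surj_pair)
      have "(i, (c, z)) = (i', (c', z'))"
      proof (rule inj_onD [OF inj])
        show "\<Phi> (i, (c, z)) = \<Phi> (i', (c', z'))" using eq by (simp add: u v)
      qed (use uv I [of i c] I [of i' c'] in \<open>auto simp: u v\<close>)
      then show "u = v" by (simp add: u v)
    qed
  qed
  moreover have "p dvd card ?I" using proper by (intro card_fibre_cells [OF K p g]) auto
  then have "int p dvd e + int (card ?I) * (-1) ^ Suc n" using e(2) by (intro dvd_add dvd_mult2) auto
  ultimately show ?case by blast
qed

text \<open>Beyond the last dimension with cells the skeleta stop growing. A fibre of the whole
  space is thus a fibre of one skeleton, to which the induction applies.\<close>

lemma skeleton_exhausts: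
  assumes "finite {n. N n \<noteq> 0}" shows "\<exists>M. topspace (Space X) = sk M"
proof -
  have step: "sk n \<subseteq> sk (Suc n) \<and> (N (Suc n) = 0 \<longrightarrow> sk (Suc n) = sk n)" for n
  proof -
    obtain \<Phi> :: "nat \<times> 'a set \<times> (nat \<Rightarrow> real) \<Rightarrow> 'x" where
      "sk (Suc n) = sk n \<union> \<Phi> ` Sigma {..<N (Suc n)}
         (\<lambda>i. topspace (Space (coset_gspace G b (H (Suc n) i))) \<times> topspace (disk (Suc n)))"
      by (rule higher_cells [of n]) (rule that; assumption)
    then show ?thesis by auto
  qed
  have mono: "sk n \<subseteq> sk (Suc n)" for n using step by (rule conjunct1)
  have stable: "N (Suc n) = 0 \<Longrightarrow> sk (Suc n) = sk n" for n using step [of n] by simp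
  obtain M where M: "\<And>n. N n \<noteq> 0 \<Longrightarrow> n \<le> M"
    using assms by (auto simp: finite_nat_set_iff_bounded_le)
  have "sk n \<subseteq> sk M" for n
  proof (cases "n \<le> M")
    case True
    then show ?thesis by (rule lift_Suc_mono_le [of sk, OF mono])
  next
    case False
    then have "M \<le> n" by simp
    then have "sk n = sk M"
    proof (induction n rule: dec_induct)
      case (step n)
      then have "N (Suc n) = 0" using M [of "Suc n"] by force
      then show ?case using step stable by simp
    qed simp
    then show ?thesis by simp
  qed
  then have "(\<Union>n. sk n) = sk M" by blast
  moreover have "topspace (Space X) = (\<Union>n. sk n)" using colimit by (simp add: colimit_of_def)
  ultimately have "topspace (Space X) = sk M" by simp
  then show ?thesis ..
qed

text \<open>When the subgroup is the full isotropy group, the orbit of the identity arrow is that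
  group itself, and right translation by its elements maps it onto itself.\<close>

lemma fixed_point_of_full_cell:
  assumes b: "b \<in> topspace (Ob G)" and i: "i < N n" "H n i = carrier (isotropy_group G b)"
  shows "\<exists>x \<in> topspace (Space X). anchor X x = b \<and> (\<forall>g \<in> carrier (isotropy_group G b). act X x g = x)"
proof -
  let ?K = "carrier (isotropy_group G b)" and ?C = "coset_gspace G b (H n i)"
  have ident: "ident G b \<in> topspace (Ar G)" "src G (ident G b) = b" "tgt G (ident G b) = b"
    using b by (simp_all add: ident_closed src_ident tgt_ident)
  have "(\<lambda>h. gcomp G h (ident G b)) ` H n i = (\<lambda>h. h) ` ?K"
    unfolding i(2)
    by (rule image_cong) (auto simp: carrier_isotropy_group dest: gcomp_ident)
  then have K_eq: "(\<lambda>h. gcomp G h (ident G b)) ` H n i = ?K" by simp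
  have K: "?K \<in> topspace (Space ?C)"
    unfolding topspace_coset_gspace K_eq [symmetric] using ident by blast
  have anchor_K: "anchor ?C ?K = b"
    using anchor_coset [OF subgroup_H [OF i(1)] ident(1,3)] ident(2) unfolding K_eq by simp
  have act_K: "act ?C ?K g = ?K" if g: "g \<in> ?K" for g
  proof -
    have "(\<lambda>f. gcomp G f g) ` ?K = ?K"
    proof (intro equalityI subsetI)
      fix f assume f: "f \<in> ?K"
      have "gcomp G f (ginv G g) \<in> ?K"
        using f g by (simp add: carrier_isotropy_group gcomp_closed ginv_closed src_ginv tgt_ginv src_gcomp tgt_gcomp)
      moreover have "gcomp G (gcomp G f (ginv G g)) g = f"
        using f g by (intro gcomp_ginv_cancel) (auto simp: carrier_isotropy_group)
      ultimately show "f \<in> (\<lambda>f. gcomp G f g) ` ?K" by (intro image_eqI) auto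
    qed (use g in \<open>auto simp: carrier_isotropy_group gcomp_closed src_gcomp tgt_gcomp\<close>)
    then show ?thesis by (simp add: coset_gspace_def)
  qed
  have arrow: "g \<in> topspace (Ar G) \<and> tgt G g = b" if "g \<in> ?K" for g
    using that by (simp add: carrier_isotropy_group)
  show ?thesis
  proof (cases n)
    case 0
    obtain \<theta> where anchor: "\<And>i c. i < N 0 \<Longrightarrow> c \<in> topspace (Space (coset_gspace G b (H 0 i))) \<Longrightarrow>
         anchor X (\<theta> (i, c)) = anchor (coset_gspace G b (H 0 i)) c"
      and act: "\<And>i c g. i < N 0 \<Longrightarrow> c \<in> topspace (Space (coset_gspace G b (H 0 i))) \<Longrightarrow> g \<in> topspace (Ar G)
         \<Longrightarrow> anchor (coset_gspace G b (H 0 i)) c = tgt G g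
         \<Longrightarrow> \<theta> (i, act (coset_gspace G b (H 0 i)) c g) = act X (\<theta> (i, c)) g"
      and sk: "sk 0 = \<theta> ` Sigma {..<N 0} (\<lambda>i. topspace (Space (coset_gspace G b (H 0 i))))"
      by (rule zero_cells) (rule that; assumption)
    have "\<theta> (i, ?K) \<in> sk 0" unfolding sk using i(1) K 0 by auto
    moreover have "anchor X (\<theta> (i, ?K)) = b" using anchor [of i ?K] i(1) K anchor_K 0 by simp
    moreover have "act X (\<theta> (i, ?K)) g = \<theta> (i, ?K)" if "g \<in> ?K" for g
      using act [of i ?K g] act_K [OF that] arrow [OF that] i(1) K anchor_K 0 by simp
    ultimately show ?thesis using skeleton_subset by blast
  next
    case (Suc m)
    \<comment> \<open>The centre of the disk, an arbitrary choice, since the action leaves the disk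
      coordinate alone.\<close>
    let ?z = "\<lambda>i. 0 :: real"
    obtain \<Phi> where anchor: "\<And>i c z. i < N (Suc m) \<Longrightarrow> c \<in> topspace (Space (coset_gspace G b (H (Suc m) i))) \<Longrightarrow>
         z \<in> topspace (disk (Suc m)) \<Longrightarrow> anchor X (\<Phi> (i, (c, z))) = anchor (coset_gspace G b (H (Suc m) i)) c"
      and act: "\<And>i c z g. i < N (Suc m) \<Longrightarrow> c \<in> topspace (Space (coset_gspace G b (H (Suc m) i))) \<Longrightarrow>
         z \<in> topspace (disk (Suc m)) \<Longrightarrow> g \<in> topspace (Ar G) \<Longrightarrow>
         anchor (coset_gspace G b (H (Suc m) i)) c = tgt G g \<Longrightarrow>
         \<Phi> (i, (act (coset_gspace G b (H (Suc m) i)) c g, z)) = act X (\<Phi> (i, (c, z))) g"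
      and sk: "sk (Suc m) = sk m \<union> \<Phi> ` Sigma {..<N (Suc m)}
         (\<lambda>i. topspace (Space (coset_gspace G b (H (Suc m) i))) \<times> topspace (disk (Suc m)))"
      by (rule higher_cells [of m]) (rule that; assumption)
    have "\<Phi> (i, (?K, ?z)) \<in> sk (Suc m)" unfolding sk using i(1) K Suc zero_in_disk by auto
    moreover have "anchor X (\<Phi> (i, (?K, ?z))) = b"
      using anchor [of i ?K ?z] i(1) K anchor_K Suc zero_in_disk by simp
    moreover have "act X (\<Phi> (i, (?K, ?z))) g = \<Phi> (i, (?K, ?z))" if "g \<in> ?K" for g
      using act [of i ?K ?z g] act_K [OF that] arrow [OF that] i(1) K anchor_K Suc zero_in_disk by simp
    ultimately show ?thesis using skeleton_subset by blast
  qed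
qed

end

theorem corollary4p22:
  fixes G :: "('o, 'a) groupoid" and b :: 'o and p :: nat
    and X :: "('x, 'o, 'a) gspace"
  assumes "topological_groupoid G"
    and "transitive_groupoid G"
    and "compact_preimages (Ar G) (Ob G) (tgt G)"
    and "path_connected_space (Ob G)"
    and "finite_CW_complex (Ob G)"
    and "b \<in> topspace (Ob G)"
    and "prime p"
    and "finite_p_group p (isotropy_group G b)"
    and "finite_G_CW_complex G b X"
    and "fibration (Space X) (Ob G) (anchor X)"
    and "multiplicative_euler_char p (Space X) (Ob G) (anchor X)"
    and "fibration (subtopology (Space X) (fixed_set G X)) (Ob G) (anchor X)"
    and "multiplicative_euler_char p (subtopology (Space X) (fixed_set G X)) (Ob G) (anchor X)"
    and "\<exists>y \<in> topspace (Ob G). mod_acyclic p (fibre (Space X) (anchor X) y)"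
  shows "\<exists>\<sigma>. G_map G (object_gspace G) X \<sigma> \<and>
           (\<forall>y \<in> topspace (Ob G). anchor X (\<sigma> y) = y)"
proof -
  interpret topological_groupoid G by fact
  obtain sk N H where G_CW: "G_CW_structure G b X sk N H" and fin: "finite {n. N n \<noteq> 0}"
    using \<open>finite_G_CW_complex G b X\<close> unfolding finite_G_CW_complex_def by blast
  interpret G_CW G b X sk N H by standard (rule G_CW)
  obtain y where y: "y \<in> topspace (Ob G)" "mod_acyclic p (fibre (Space X) (anchor X) y)"
    using assms(14) by (rule bexE)
  \<comment> \<open>Acyclicity is given over \<open>y\<close>, while the cells are modelled on
    arrows into \<open>b\<close>; the arrow \<open>g\<close> lets cosets be counted over
    \<open>y\<close>.\<close>
  obtain g where g: "g \<in> topspace (Ar G)" "src G g = y" "tgt G g = b"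
    using arrow_exists [OF \<open>transitive_groupoid G\<close> y(1) \<open>b \<in> topspace (Ob G)\<close>] by blast
  obtain M where M: "topspace (Space X) = sk M" using skeleton_exhausts [OF fin] by blast
  obtain n i where i: "i < N n" "H n i = carrier (isotropy_group G b)"
  proof (rule ccontr)
    assume "\<not> thesis"
    then have "\<And>m i. i < N m \<Longrightarrow> H m i \<noteq> carrier (isotropy_group G b)" using that by metis
    from skeleton_fibre_euler_char [OF \<open>finite_p_group p (isotropy_group G b)\<close> \<open>prime p\<close> g this, of M]
    obtain e where e: "has_mod_euler_char p (subtopology (Space X) {x \<in> sk M. anchor X x = y}) e"
      and dvd: "int p dvd e"
      by blast
    have "{x \<in> sk M. anchor X x = y} = topspace (Space X) \<inter> {x. anchor X x = y}"
      unfolding M by auto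
    then have "subtopology (Space X) {x \<in> sk M. anchor X x = y} = fibre (Space X) (anchor X) y"
      by (simp only: fibre_def subtopology_restrict)
    with e have "e = 1" using mod_acyclic_euler_char [OF \<open>prime p\<close> y(2)] by simp
    then show False using dvd \<open>prime p\<close> by simp
  qed
  obtain x where x: "x \<in> topspace (Space X)" "anchor X x = b"
    and "\<forall>g \<in> carrier (isotropy_group G b). act X x g = x"
    using fixed_point_of_full_cell [OF \<open>b \<in> topspace (Ob G)\<close> i] by blast
  then show ?thesis
    by (intro equivariant_section_of_fixed_point [OF assms(2,3,6) space x]) simp
qed

end
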